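(* The eventual adaptation problem is undecidable in $\mathcal{E}_d^3$.
   Context: Fix a countably infinite set $\mathcal N$ of names. Prefixes are $\pi ::= a \mid \overline{a} \mid \widetilde{a}\{U\}$. Processes: $P ::= a[P] \mid P\parallel P \mid \sum_{i\in I}\pi_i.P_i \mid\ !\pi.P$ ($I$ finite, $\mathbf 0$ the empty sum). $\mathcal E_d^3$: processes in which every update pattern $U$ (at any depth) is generated by $U::= a[U]\mid U\parallel P\mid\bullet$ with $P$ an $\mathcal E_d^3$ process. $U\{Q\}$ replaces the hole(s) of $U$ by $Q$. Dynamic semantics: $a[P]\xrightarrow{a[P]}\star$ ($\star$ a placeholder); $\sum_{i\in I}\pi_i.P_i\xrightarrow{\pi_j}P_j$; $!\pi.P\xrightarrow{\pi}P\parallel!\pi.P$; if $P\xrightarrow\alpha P'$ then $a[P]\xrightarrow\alpha a[P']$; labels propagate through either side of $\parallel$; $a$ and $\overline a$ in parallel components synchronise to $\tau$; if $P_1\xrightarrow{a[Q]}P_1'$ and $P_2\xrightarrow{\widetilde a\{U\}}P_2'$ then $P_1\parallel P_2\xrightarrow\tau P_1'[U\{Q\}/\star]\parallel P_2'$ (and symmetrically). $P\to P'$ means $P\xrightarrow\tau P'$. $P\downarrow_\alpha$ iff $P\xrightarrow\alpha P'$ for some $P'$ ($\alpha\in\{a,\overline a\}$); $P\Downarrow^\omega_\alpha$ iff there is an infinite computation $P\to^*Q_1\to Q_2\to\cdots$ with $Q_i\downarrow_\alpha$ for all $i$. For $M=\{P_1,\dots,P_n\}$, $\mathcal{BC}^M_P=\{P\parallel\prod^{m_1}P_1\parallel\cdots\parallel\prod^{m_n}P_n\mid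 m_i\in\mathbb N\}$. Eventual adaptation in $\mathcal E_d^3$: given $\mathcal E_d^3$ processes $P$ and finite $M$, and a barb $e$, decide whether no $R\in\mathcal{BC}^M_P$ satisfies $R\Downarrow^\omega_e$. *)

theory Defs
  imports "HOL-Library.Nat_Bijection"
begin

section \<open>Syntax\<close>

type_synonym name = nat

datatype act = In name | Out name

text \<open>
  The update patterns are exactly those generated by \<open>U ::= a[U] | U \<parallel> P | \<bullet>\<close>, at every depth, so
  the terms of type \<open>proc\<close> without \<open>Star\<close> are the processes of the calculus with dynamic topology
  and this class of patterns. \<open>Star\<close> is the placeholder of the operational semantics: it is not part
  of the process syntax, and only occurs in the targets of transitions labelled \<open>a[P]\<close>.
  A finite sum is given by the list of its summands.
\<close>

datatype proc =
    Loc name proc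
  | Par proc proc
  | Sum "(prefix \<times> proc) list"
  | Bang prefix proc
  | Star
and prefix = Act act | Upd name upat
and upat = ULoc name upat | UPar upat proc | Hole

abbreviation Nil_proc :: proc where
  "Nil_proc \<equiv> Sum []"

fun star_free :: "proc \<Rightarrow> bool"
  and star_free_prefix :: "prefix \<Rightarrow> bool"
  and star_free_upat :: "upat \<Rightarrow> bool" where
  "star_free (Loc a P) \<longleftrightarrow> star_free P"
| "star_free (Par P Q) \<longleftrightarrow> star_free P \<and> star_free Q"
| "star_free (Sum bs) \<longleftrightarrow> (\<forall>(p, P)\<in>set bs. star_free_prefix p \<and> star_free P)"
| "star_free (Bang p P) \<longleftrightarrow> star_free_prefix p \<and> star_free P"
| "star_free Star \<longleftrightarrow> False"
| "star_free_prefix (Act x) \<longleftrightarrow> True"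
| "star_free_prefix (Upd a U) \<longleftrightarrow> star_free_upat U"
| "star_free_upat (ULoc a U) \<longleftrightarrow> star_free_upat U"
| "star_free_upat (UPar U P) \<longleftrightarrow> star_free_upat U \<and> star_free P"
| "star_free_upat Hole \<longleftrightarrow> True"

fun fill :: "upat \<Rightarrow> proc \<Rightarrow> proc" where
  "fill (ULoc a U) Q = Loc a (fill U Q)"
| "fill (UPar U P) Q = Par (fill U Q) P"
| "fill Hole Q = Q"

text \<open>\<open>subst_star R P\<close> is \<open>P[R/\<star>]\<close>.\<close>

fun subst_star :: "proc \<Rightarrow> proc \<Rightarrow> proc"
  and subst_star_prefix :: "proc \<Rightarrow> prefix \<Rightarrow> prefix"
  and subst_star_upat :: "proc \<Rightarrow> upat \<Rightarrow> upat" where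
  "subst_star R (Loc a P) = Loc a (subst_star R P)"
| "subst_star R (Par P Q) = Par (subst_star R P) (subst_star R Q)"
| "subst_star R (Sum bs) = Sum (map (\<lambda>(p, P). (subst_star_prefix R p, subst_star R P)) bs)"
| "subst_star R (Bang p P) = Bang (subst_star_prefix R p) (subst_star R P)"
| "subst_star R Star = R"
| "subst_star_prefix R (Act x) = Act x"
| "subst_star_prefix R (Upd a U) = Upd a (subst_star_upat R U)"
| "subst_star_upat R (ULoc a U) = ULoc a (subst_star_upat R U)"
| "subst_star_upat R (UPar U P) = UPar (subst_star_upat R U) (subst_star R P)"
| "subst_star_upat R Hole = Hole"

section \<open>Operational semantics\<close>

text \<open>The label \<open>Offer a P\<close> is \<open>a[P]\<close>.\<close>

datatype label = Pre prefix | Offer name proc | Tau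

inductive step :: "proc \<Rightarrow> label \<Rightarrow> proc \<Rightarrow> bool" where
  offer: "step (Loc a P) (Offer a P) Star"
| sum: "(p, P) \<in> set bs \<Longrightarrow> step (Sum bs) (Pre p) P"
| bang: "step (Bang p P) (Pre p) (Par P (Bang p P))"
| loc: "step P l P' \<Longrightarrow> step (Loc a P) l (Loc a P')"
| par_left: "step P l P' \<Longrightarrow> step (Par P Q) l (Par P' Q)"
| par_right: "step Q l Q' \<Longrightarrow> step (Par P Q) l (Par P Q')"
| comm_left: "step P (Pre (Act (In a))) P' \<Longrightarrow> step Q (Pre (Act (Out a))) Q' \<Longrightarrow>
    step (Par P Q) Tau (Par P' Q')"
| comm_right: "step P (Pre (Act (Out a))) P' \<Longrightarrow> step Q (Pre (Act (In a))) Q' \<Longrightarrow>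
    step (Par P Q) Tau (Par P' Q')"
| update_left: "step P (Offer a R) P' \<Longrightarrow> step Q (Pre (Upd a U)) Q' \<Longrightarrow>
    step (Par P Q) Tau (Par (subst_star (fill U R) P') Q')"
| update_right: "step P (Pre (Upd a U)) P' \<Longrightarrow> step Q (Offer a R) Q' \<Longrightarrow>
    step (Par P Q) Tau (Par P' (subst_star (fill U R) Q'))"

definition reduces :: "proc \<Rightarrow> proc \<Rightarrow> bool" where
  "reduces P P' \<longleftrightarrow> step P Tau P'"

definition barb :: "proc \<Rightarrow> act \<Rightarrow> bool" where
  "barb P e \<longleftrightarrow> (\<exists>P'. step P (Pre (Act e)) P')"

definition omega_barb :: "proc \<Rightarrow> act \<Rightarrow> bool" where
  "omega_barb P e \<longleftrightarrow>
    (\<exists>Q. reduces\<^sup>*\<^sup>* P (Q 0) \<and> (\<forall>i::nat. reduces (Q i) (Q (Suc i)) \<and> barb (Q i) e))"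

section \<open>The eventual adaptation problem\<close>

fun par_power :: "nat \<Rightarrow> proc \<Rightarrow> proc" where
  "par_power 0 P = Nil_proc"
| "par_power (Suc 0) P = P"
| "par_power (Suc (Suc m)) P = Par P (par_power (Suc m) P)"

definition cluster :: "proc list \<Rightarrow> proc \<Rightarrow> proc set" where
  "cluster Ms P = {foldl Par P (map2 par_power ms Ms) | ms. length ms = length Ms}"

text \<open>
  An instance consists of the process \<open>P\<close>, the finite set \<open>M\<close>, presented by a list without
  repetitions, and the barb.
\<close>

type_synonym adaptation_instance = "proc \<times> proc list \<times> act"

definition adaptation_instances :: "adaptation_instance set" where
  "adaptation_instances =
    {(P, Ms, e). star_free P \<and> (\<forall>Q\<in>set Ms. star_free Q) \<and> distinct Ms}"

definition eventual_adaptation :: "adaptation_instance set" where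
  "eventual_adaptation = {(P, Ms, e). \<not> (\<exists>R\<in>cluster Ms P. omega_barb R e)}"

section \<open>Decidability\<close>

text \<open>
  \<open>recursive k f\<close>: \<open>f\<close> is a general recursive function of \<open>k\<close> arguments, passed as a list of
  length \<open>k\<close>; its values on lists of other lengths are irrelevant. Minimisation is only applied
  to regular functions, hence all recursive functions are total.
\<close>

inductive recursive :: "nat \<Rightarrow> (nat list \<Rightarrow> nat) \<Rightarrow> bool" where
  zero: "recursive k (\<lambda>xs. 0)"
| succ: "recursive 1 (\<lambda>xs. Suc (xs ! 0))"
| proj: "i < k \<Longrightarrow> recursive k (\<lambda>xs. xs ! i)"
| comp: "recursive (length gs) f \<Longrightarrow> (\<forall>g\<in>set gs. recursive k g) \<Longrightarrow>
    recursive k (\<lambda>xs. f (map (\<lambda>g. g xs) gs))"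
| prim_rec: "recursive k f \<Longrightarrow> recursive (Suc (Suc k)) g \<Longrightarrow>
    recursive (Suc k) (\<lambda>xs. rec_nat (f (tl xs)) (\<lambda>n r. g (n # r # tl xs)) (hd xs))"
| minimise: "recursive (Suc k) f \<Longrightarrow> (\<forall>xs. length xs = k \<longrightarrow> (\<exists>n. f (n # xs) = 0)) \<Longrightarrow>
    recursive k (\<lambda>xs. LEAST n. f (n # xs) = 0)"

text \<open>
  The problem with instances \<open>I\<close> and positive instances \<open>A\<close>, where \<open>code\<close> represents instances by
  natural numbers. A decision procedure only has to answer correctly on codes of instances.
\<close>

definition decidable :: "('a \<Rightarrow> nat) \<Rightarrow> 'a set \<Rightarrow> 'a set \<Rightarrow> bool" where
  "decidable code I A \<longleftrightarrow>
    (\<exists>f. recursive 1 f \<and> (\<forall>x\<in>I. f [code x] = (if x \<in> A then 1 else 0)))"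

fun encode_act :: "act \<Rightarrow> nat" where
  "encode_act (In a) = prod_encode (0, a)"
| "encode_act (Out a) = prod_encode (1, a)"

fun encode_proc :: "proc \<Rightarrow> nat"
  and encode_prefix :: "prefix \<Rightarrow> nat"
  and encode_upat :: "upat \<Rightarrow> nat" where
  "encode_proc (Loc a P) = prod_encode (0, prod_encode (a, encode_proc P))"
| "encode_proc (Par P Q) = prod_encode (1, prod_encode (encode_proc P, encode_proc Q))"
| "encode_proc (Sum bs) =
    prod_encode (2, list_encode (map (\<lambda>(p, P). prod_encode (encode_prefix p, encode_proc P)) bs))"
| "encode_proc (Bang p P) = prod_encode (3, prod_encode (encode_prefix p, encode_proc P))"
| "encode_proc Star = prod_encode (4, 0)"
| "encode_prefix (Act x) = prod_encode (0, encode_act x)"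
| "encode_prefix (Upd a U) = prod_encode (1, prod_encode (a, encode_upat U))"
| "encode_upat (ULoc a U) = prod_encode (0, prod_encode (a, encode_upat U))"
| "encode_upat (UPar U P) = prod_encode (1, prod_encode (encode_upat U, encode_proc P))"
| "encode_upat Hole = prod_encode (2, 0)"

fun encode_instance :: "adaptation_instance \<Rightarrow> nat" where
  "encode_instance (P, Ms, e) =
    prod_encode (encode_proc P, prod_encode (list_encode (map encode_proc Ms), encode_act e))"

text \<open>The coding is unambiguous.\<close>

lemma encode_act_eq [simp]: "encode_act x = encode_act y \<longleftrightarrow> x = y"
  by (cases x; cases y) auto

lemma encode_inj_aux:
  "encode_proc P = encode_proc P' \<Longrightarrow> P = P'"
  "encode_prefix p = encode_prefix p' \<Longrightarrow> p = p'"
  "encode_upat U = encode_upat U' \<Longrightarrow> U = U'"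
proof (induction P and p and U arbitrary: P' and p' and U'
    rule: encode_proc_encode_prefix_encode_upat.induct)
  case (3 bs)
  then obtain cs where cs: "P' = Sum cs" by (cases P') auto
  with 3 have "map (\<lambda>(p, P). prod_encode (encode_prefix p, encode_proc P)) bs =
    map (\<lambda>(p, P). prod_encode (encode_prefix p, encode_proc P)) cs"
    by (simp add: list_encode_eq)
  moreover have "b = c" if "b \<in> set bs"
    "(\<lambda>(p, P). prod_encode (encode_prefix p, encode_proc P)) b =
     (\<lambda>(p, P). prod_encode (encode_prefix p, encode_proc P)) c" for b c
  proof -
    obtain p P p' Q where bc: "b = (p, P)" "c = (p', Q)" by (cases b; cases c)
    have "encode_prefix p = encode_prefix p'" "encode_proc P = encode_proc Q"
      using that(2) bc by simp_all
    then have "p = p'" "P = Q"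
      using "3.IH"(1)[OF that(1) bc(1)[symmetric]] "3.IH"(2)[OF that(1) bc(1)[symmetric]]
      by blast+
    then show ?thesis
      using bc by simp
  qed
  ultimately have "bs = cs"
  proof (induction bs arbitrary: cs)
    case Nil
    then show ?case by simp
  next
    case (Cons b bs)
    then obtain c cs' where cs: "cs = c # cs'" by (cases cs) auto
    have "b = c" by (rule Cons.prems(2)) (use Cons.prems(1) cs in simp_all)
    moreover have "bs = cs'"
      by (rule Cons.IH) (use Cons.prems cs in simp_all)
    ultimately show ?case using cs by simp
  qed
  then show ?case using cs by simp
next
  case (1 a P)
  from "1.prems" obtain b Q where *: "P' = Loc b Q"
    by (cases P') simp_all
  with "1.prems" have "a = b" "encode_proc P = encode_proc Q"
    by simp_all
  with * "1.IH" show ?case by blast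
next
  case (2 P Q)
  from "2.prems" obtain R R' where *: "P' = Par R R'"
    by (cases P') simp_all
  with "2.prems" have "encode_proc P = encode_proc R" "encode_proc Q = encode_proc R'"
    by simp_all
  with * "2.IH" show ?case by blast
next
  case (4 p P)
  from "4.prems" obtain q Q where *: "P' = Bang q Q"
    by (cases P') simp_all
  with "4.prems" have "encode_prefix p = encode_prefix q" "encode_proc P = encode_proc Q"
    by simp_all
  with * "4.IH" show ?case by blast
next
  case 5
  then show ?case by (cases P') simp_all
next
  case (6 x)
  then show ?case by (cases p') simp_all
next
  case (7 a U)
  from "7.prems" obtain b V where *: "p' = Upd b V"
    by (cases p') simp_all
  with "7.prems" have "a = b" "encode_upat U = encode_upat V"
    by simp_all
  with * "7.IH" show ?case by blast
next
  case (8 a U)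
  from "8.prems" obtain b V where *: "U' = ULoc b V"
    by (cases U') simp_all
  with "8.prems" have "a = b" "encode_upat U = encode_upat V"
    by simp_all
  with * "8.IH" show ?case by blast
next
  case (9 U P)
  from "9.prems" obtain V Q where *: "U' = UPar V Q"
    by (cases U') simp_all
  with "9.prems" have "encode_upat U = encode_upat V" "encode_proc P = encode_proc Q"
    by simp_all
  with * "9.IH" show ?case by blast
next
  case 10
  then show ?case by (cases U') simp_all
qed

lemma inj_encode_instance: "inj encode_instance"
proof (rule injI)
  have *: "inj encode_proc"
    using encode_inj_aux(1) by (rule injI)
  fix x y :: adaptation_instance
  assume "encode_instance x = encode_instance y"
  then show "x = y"
    by (cases x; cases y) (auto simp: list_encode_eq inj_map_eq_map[OF *] dest: encode_inj_aux(1))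
qed

end

theory Submission
  imports Defs "HOL-Library.Multiset"
begin

text \<open>
  A register machine is simulated by a process with unreliable zero tests. Register \<open>r\<close> is a location
  containing its units and a lock location, and a unit is a process that can update the lock of \<open>r\<close>
  once it has been opened. A zero test wraps the whole contents of the register into a fresh lock. All
  communications cross locations, but a process can not update a location that it is inside of:
  units that were present at a zero test are inside the new lock and can never be used again.
  A zero test is thus a reset, which loses the units if the register was not zero.

  Every instruction turns fuel into a unit or into ash, or a unit into ash, and the total is never
  increased. When the machine halts, ash is turned back into fuel and the machine restarts. The
  cluster provides an arbitrary finite amount of fuel. In an infinite run the machine halts
  infinitely often, since it runs out of fuel otherwise, and only finitely many zero tests are
  wrong, since each of them loses a unit. Hence an infinite run exists for some amount of fuel iff the machine halts.

  Given a decision procedure \<open>f\<close>, let the machine with input \<open>n\<close> apply \<open>f\<close> to the instance consisting of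
  the process with code \<open>n\<close> and a loader for the input \<open>n\<close>, and halt iff the answer is 1. On its own
  code this contradicts the correctness of \<open>f\<close>.
\<close>

section \<open>Processes up to structural congruence\<close>

text \<open>The server for label 0 is replicated and never disappears, so the barb
  \<open>In 2\<close> holds in every state and the question becomes whether some member of the
  cluster diverges. The branch of \<open>DecJz\<close> is guessed: a wrong decrement waits for a
  unit forever and blocks, a wrong zero test costs units. Before a reset the old lock is renamed to
  0. Otherwise it would keep the name \<open>lock_loc r\<close> inside the new lock and compete with
  it; no thread ever updates location 0. A decrement is a handshake through the name of the lock:
  the control renames it to \<open>open_loc r\<close>, a unit lying beside it renames it back and
  vanishes, and only then can the control proceed. A restart keeps the registers. The machine must
  therefore behave uniformly for all initial contents and halt with the same contents each time; a
  round then returns exactly the resources it used. The diagonal argument needs no universal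
  machine: the code of \<open>Q\<close> enters the code of the instance literally, so only the code
  of the loader has to be computed.\<close>

datatype item = Thr proc | Box name "item multiset"

text \<open>Parallel composition is taken modulo associativity, commutativity and the null process,
  but only in active position: continuations under prefixes stay terms until they are
  released.\<close>

fun flat :: "proc \<Rightarrow> item multiset" where
  "flat (Loc a P) = {#Box a (flat P)#}"
| "flat (Par P Q) = flat P + flat Q"
| "flat (Sum bs) = (if bs = [] then {#} else {#Thr (Sum bs)#})"
| "flat (Bang p P) = {#Thr (Bang p P)#}"
| "flat Star = {#}"

text \<open>The recursion descends through \<open>Loc\<close> and \<open>Par\<close> only, the
  active contexts, which avoids the mutual induction over prefixes and patterns.\<close>

lemmas proc_induct = flat.induct[case_names Loc Par Sum Bang Star]

fun flat_upat :: "upat \<Rightarrow> item multiset \<Rightarrow> item multiset" where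
  "flat_upat (ULoc a U) M = {#Box a (flat_upat U M)#}"
| "flat_upat (UPar U P) M = flat_upat U M + flat P"
| "flat_upat Hole M = M"

lemma flat_fill: "flat (fill U R) = flat_upat U (flat R)"
  by (induction U) auto

inductive item_act :: "item \<Rightarrow> prefix \<Rightarrow> item multiset \<Rightarrow> bool" where
  sum: "(p, P) \<in> set bs \<Longrightarrow> item_act (Thr (Sum bs)) p (flat P)"
| bang: "item_act (Thr (Bang p P)) p (add_mset (Thr (Bang p P)) (flat P))"
| box: "item_act i p I \<Longrightarrow> item_act (Box a (add_mset i K)) p {#Box a (I + K)#}"

text \<open>The offer of a location and the later refilling of \<open>Star\<close> are merged into
  one relation, so that multisets need neither placeholders nor offer labels.\<close>

inductive item_upd :: "item \<Rightarrow> name \<Rightarrow> upat \<Rightarrow> item multiset \<Rightarrow> bool" where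
  here: "item_upd (Box a M) a U (flat_upat U M)"
| box: "item_upd i a U I \<Longrightarrow> item_upd (Box b (add_mset i K)) a U {#Box b (I + K)#}"

text \<open>
  An update needs two different items: a thread can not update a location that it is inside of.
\<close>

inductive soup_tau :: "item multiset \<Rightarrow> item multiset \<Rightarrow> bool" where
  comm: "item_act i (Act (In a)) I \<Longrightarrow> item_act j (Act (Out a)) J \<Longrightarrow>
    soup_tau (add_mset i (add_mset j K)) (I + J + K)"
| upd: "item_act i (Upd a U) I \<Longrightarrow> item_upd j a U J \<Longrightarrow>
    soup_tau (add_mset i (add_mset j K)) (I + J + K)"
| box: "soup_tau M M' \<Longrightarrow> soup_tau (add_mset (Box a M) K) (add_mset (Box a M') K)"

lemma soup_tau_frame: "soup_tau M M' \<Longrightarrow> soup_tau (M + K) (M' + K)"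
proof (induction rule: soup_tau.induct)
  case (comm i a I j J K')
  then show ?case using soup_tau.comm[of i a I j J "K' + K"] by (simp add: ac_simps)
next
  case (upd i a U I j J K')
  then show ?case using soup_tau.upd[of i a U I j J "K' + K"] by (simp add: ac_simps)
next
  case (box M M' a K')
  then show ?case using soup_tau.box[of M M' a "K' + K"] by simp
qed

lemma item_act_thr_Sum: "item_act (Thr (Sum bs)) p I \<longleftrightarrow> (\<exists>P. (p, P) \<in> set bs \<and> I = flat P)"
  by (auto elim: item_act.cases intro: item_act.intros)

lemma item_act_thr_Bang:
  "item_act (Thr (Bang p P)) q I \<longleftrightarrow> q = p \<and> I = add_mset (Thr (Bang p P)) (flat P)"
  by (auto elim: item_act.cases intro: item_act.intros)

lemma item_act_Box: "item_act (Box a M) p I \<longleftrightarrow>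
    (\<exists>i K J. M = add_mset i K \<and> item_act i p J \<and> I = {#Box a (J + K)#})"
  by (rule iffI, erule item_act.cases) (auto intro: item_act.box)

lemma item_upd_Thr [simp]: "\<not> item_upd (Thr P) a U I"
  by (auto elim: item_upd.cases)

lemma item_upd_Box: "item_upd (Box b M) a U I \<longleftrightarrow> b = a \<and> I = flat_upat U M \<or>
    (\<exists>i K J. M = add_mset i K \<and> item_upd i a U J \<and> I = {#Box b (J + K)#})"
  by (rule iffI, erule item_upd.cases) (auto intro: item_upd.intros)

section \<open>From transitions of terms to transitions of multisets\<close>

lemma subst_star_star_free:
  "star_free P \<Longrightarrow> subst_star R P = P"
  "star_free_prefix p \<Longrightarrow> subst_star_prefix R p = p"
  "star_free_upat U \<Longrightarrow> subst_star_upat R U = U"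
proof (induction P and p and U rule: star_free_star_free_prefix_star_free_upat.induct)
  case (3 bs)
  then show ?case by (auto intro!: map_idI)
qed auto

lemma star_free_fill: "star_free_upat U \<Longrightarrow> star_free R \<Longrightarrow> star_free (fill U R)"
  by (induction U) auto

lemma step_Pre:
  assumes "step P l P'" "l = Pre p"
  shows "(\<exists>i I K. flat P = add_mset i K \<and> item_act i p I \<and> flat P' = I + K) \<and>
    (star_free P \<longrightarrow> star_free P' \<and> star_free_prefix p)"
  using assms
proof (induction rule: step.induct)
  case (sum q P bs)
  then have "flat (Sum bs) = add_mset (Thr (Sum bs)) {#}"
    and "item_act (Thr (Sum bs)) p (flat P)"
    by (auto intro: item_act.sum)
  with sum show ?case by fastforce
next
  case (bang q P)
  then show ?case by (auto simp: item_act_thr_Bang)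
next
  case (loc P l P' a)
  then obtain i I K where "flat P = add_mset i K" "item_act i p I" "flat P' = I + K" by blast
  then have "item_act (Box a (flat P)) p {#Box a (flat P')#}"
    by (metis item_act.box)
  with loc show ?case by fastforce
next
  case (par_left P l P' Q)
  then obtain i I K where "flat P = add_mset i K" "item_act i p I" "flat P' = I + K" by blast
  then have "flat (Par P Q) = add_mset i (K + flat Q)" "flat (Par P' Q) = I + (K + flat Q)"
    by simp_all
  with \<open>item_act i p I\<close> par_left show ?case by fastforce
next
  case (par_right Q l Q' P)
  then obtain i I K where "flat Q = add_mset i K" "item_act i p I" "flat Q' = I + K" by blast
  then have "flat (Par P Q) = add_mset i (K + flat P)" "flat (Par P Q') = I + (K + flat P)"
    by (simp_all add: ac_simps)
  with \<open>item_act i p I\<close> par_right show ?case by fastforce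
qed auto

text \<open>Only the refilled target is meaningful as a multiset. Since \<open>P\<close> is
  star-free, the one placeholder is where the location was taken out, and the substitution leaves
  everything beside it unchanged.\<close>

lemma step_Offer:
  assumes "step P l P'" "l = Offer a R" "star_free P"
  shows "(\<exists>i I K. flat P = add_mset i K \<and> item_upd i a U I \<and>
      flat (subst_star (fill U R) P') = I + K) \<and>
    (star_free_upat U \<longrightarrow> star_free (subst_star (fill U R) P'))"
  using assms
proof (induction rule: step.induct)
  case (offer b P)
  then show ?case by (auto simp: flat_fill star_free_fill intro: item_upd.here)
next
  case (loc P l P' b)
  then obtain i I K where "flat P = add_mset i K" "item_upd i a U I"
    "flat (subst_star (fill U R) P') = I + K" by auto
  then have "item_upd (Box b (flat P)) a U {#Box b (flat (subst_star (fill U R) P'))#}"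
    by (metis item_upd.box)
  with loc show ?case by fastforce
next
  case (par_left P l P' Q)
  then obtain i I K where *: "flat P = add_mset i K" "item_upd i a U I"
    "flat (subst_star (fill U R) P') = I + K" by auto
  then have "flat (Par P Q) = add_mset i (K + flat Q)"
    "flat (subst_star (fill U R) (Par P' Q)) = I + (K + flat Q)"
    using par_left by (simp_all add: subst_star_star_free)
  with * par_left show ?case by (fastforce simp: subst_star_star_free)
next
  case (par_right Q l Q' P)
  then obtain i I K where *: "flat Q = add_mset i K" "item_upd i a U I"
    "flat (subst_star (fill U R) Q') = I + K" by auto
  then have "flat (Par P Q) = add_mset i (K + flat P)"
    "flat (subst_star (fill U R) (Par P Q')) = I + (K + flat P)"
    using par_right by (simp_all add: subst_star_star_free ac_simps)
  with * par_right show ?case by (fastforce simp: subst_star_star_free)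
qed auto

lemma soup_tau_comm:
  assumes "M = add_mset i K" "item_act i (Act (In a)) I" "M' = I + K"
    and "N = add_mset j L" "item_act j (Act (Out a)) J" "N' = J + L"
  shows "soup_tau (M + N) (M' + N')"
  using soup_tau.comm[OF assms(2,5), of "K + L"] assms by (simp add: ac_simps add_mset_commute)

lemma soup_tau_upd:
  assumes "M = add_mset i K" "item_act i (Upd a U) I" "M' = I + K"
    and "N = add_mset j L" "item_upd j a U J" "N' = J + L"
  shows "soup_tau (M + N) (M' + N')"
  using soup_tau.upd[OF assms(2,5), of "K + L"] assms by (simp add: ac_simps add_mset_commute)

lemma step_Tau:
  assumes "step P l P'" "l = Tau" "star_free P"
  shows "soup_tau (flat P) (flat P') \<and> star_free P'"
  using assms
proof (induction rule: step.induct)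
  case (loc P l P' a)
  then show ?case using soup_tau.box[of "flat P" "flat P'" a "{#}"] by simp
next
  case (par_left P l P' Q)
  then show ?case by (simp add: soup_tau_frame)
next
  case (par_right Q l Q' P)
  then show ?case by (simp add: soup_tau_frame add.commute[of "flat P"])
next
  case (comm_left P a P' Q Q')
  from step_Pre[OF comm_left(1) refl] step_Pre[OF comm_left(2) refl] comm_left
  show ?case using soup_tau_comm by fastforce
next
  case (comm_right P a P' Q Q')
  from step_Pre[OF comm_right(1) refl] step_Pre[OF comm_right(2) refl] comm_right
  have "soup_tau (flat Q + flat P) (flat Q' + flat P')" "star_free (Par P' Q')"
    using soup_tau_comm by fastforce+
  then show ?case by (simp add: add.commute)
next
  case (update_left P a R P' Q U Q')
  have "star_free P" using update_left by simp
  from step_Offer[OF update_left(1) refl this, of U] step_Pre[OF update_left(2) refl] update_left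
  have "soup_tau (flat Q + flat P) (flat Q' + flat (subst_star (fill U R) P'))"
    "star_free (Par (subst_star (fill U R) P') Q')"
    using soup_tau_upd by fastforce+
  then show ?case by (simp add: add.commute)
next
  case (update_right P a U P' Q R Q')
  have "star_free Q" using update_right by simp
  from step_Offer[OF update_right(2) refl this, of U] step_Pre[OF update_right(1) refl] update_right
  show ?case using soup_tau_upd by fastforce
qed auto

section \<open>From transitions of multisets back to transitions of terms\<close>

lemma Pre_step:
  "flat P = add_mset i K \<Longrightarrow> item_act i p I \<Longrightarrow> \<exists>P'. step P (Pre p) P' \<and> flat P' = I + K"
proof (induction P arbitrary: i K I rule: proc_induct)
  case (Loc a P)
  then have "i = Box a (flat P)" "K = {#}" by auto
  with Loc obtain j L J where "flat P = add_mset j L" "item_act j p J" "I = {#Box a (J + L)#}"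
    by (auto simp: item_act_Box)
  with Loc.IH \<open>K = {#}\<close> show ?case by (fastforce intro: step.loc)
next
  case (Par P Q)
  then have "i \<in># flat P + flat Q" by simp
  then consider "i \<in># flat P" | "i \<in># flat Q" by auto
  then show ?case
  proof cases
    case 1
    then obtain L where L: "flat P = add_mset i L" by (metis multi_member_split)
    with Par obtain P' where "step P (Pre p) P'" "flat P' = I + L" by blast
    moreover have "K = L + flat Q" using L Par by simp
    ultimately show ?thesis by (intro exI[of _ "Par P' Q"]) (auto intro: step.par_left)
  next
    case 2
    then obtain L where L: "flat Q = add_mset i L" by (metis multi_member_split)
    with Par obtain Q' where "step Q (Pre p) Q'" "flat Q' = I + L" by blast
    moreover have "K = flat P + L" using L Par by simp
    ultimately show ?thesis by (intro exI[of _ "Par P Q'"]) (auto intro: step.par_right)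
  qed
next
  case (Sum bs)
  then show ?case by (auto simp: item_act_thr_Sum split: if_splits intro: step.sum)
next
  case (Bang q P)
  then show ?case by (auto simp: item_act_thr_Bang intro!: exI[of _ "Par P (Bang q P)"] step.bang)
qed auto

lemma Offer_step:
  "flat P = add_mset i K \<Longrightarrow> item_upd i a U I \<Longrightarrow> star_free P \<Longrightarrow>
    \<exists>R P'. step P (Offer a R) P' \<and> flat (subst_star (fill U R) P') = I + K"
proof (induction P arbitrary: i K I rule: proc_induct)
  case (Loc b P)
  then have iK: "i = Box b (flat P)" "K = {#}" by auto
  with Loc consider "b = a" "I = flat_upat U (flat P)"
    | j L J where "flat P = add_mset j L" "item_upd j a U J" "I = {#Box b (J + L)#}"
    by (auto simp: item_upd_Box)
  then show ?case
  proof cases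
    case 1
    then show ?thesis using iK
      by (intro exI[of _ P] exI[of _ Star]) (auto simp: flat_fill intro: step.offer)
  next
    case 2
    with Loc obtain R P' where "step P (Offer a R) P'" "flat (subst_star (fill U R) P') = J + L"
      by fastforce
    with 2 iK show ?thesis by (intro exI[of _ R] exI[of _ "Loc b P'"]) (auto intro: step.loc)
  qed
next
  case (Par P Q)
  then have "i \<in># flat P + flat Q" by simp
  then consider "i \<in># flat P" | "i \<in># flat Q" by auto
  then show ?case
  proof cases
    case 1
    then obtain L where L: "flat P = add_mset i L" by (metis multi_member_split)
    with Par obtain R P' where "step P (Offer a R) P'" "flat (subst_star (fill U R) P') = I + L"
      by fastforce
    moreover have "K = L + flat Q" using L Par by simp
    ultimately show ?thesis using Par.prems
      by (intro exI[of _ R] exI[of _ "Par P' Q"])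
        (auto simp: subst_star_star_free intro: step.par_left)
  next
    case 2
    then obtain L where L: "flat Q = add_mset i L" by (metis multi_member_split)
    with Par obtain R Q' where "step Q (Offer a R) Q'" "flat (subst_star (fill U R) Q') = I + L"
      by fastforce
    moreover have "K = flat P + L" using L Par by simp
    ultimately show ?thesis using Par.prems
      by (intro exI[of _ R] exI[of _ "Par P Q'"])
        (auto simp: subst_star_star_free intro: step.par_right)
  qed
qed (auto split: if_splits)

text \<open>Used with \<open>A\<close> and \<open>B\<close> as the two sides of a parallel
  composition and \<open>i\<close>, \<open>j\<close> as the partners of a reduction: either one side
  contains both, which is left to the induction, or the reduction happens at this very
  composition.\<close>

lemma add_mset_two_cases:
  assumes "A + B = add_mset i (add_mset j K)"
  obtains L where "A = add_mset i (add_mset j L)" "K = L + B"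
  | L where "B = add_mset i (add_mset j L)" "K = A + L"
  | L L' where "A = add_mset i L" "B = add_mset j L'" "K = L + L'"
  | L L' where "A = add_mset j L" "B = add_mset i L'" "K = L + L'"
proof -
  have "i \<in># A + B" using assms by simp
  then consider "i \<in># A" | "i \<in># B" by auto
  then show ?thesis
  proof cases
    case 1
    then obtain L where L: "A = add_mset i L" by (metis multi_member_split)
    then have LB: "L + B = add_mset j K" using assms by simp
    then have "j \<in># L + B" by simp
    then consider "j \<in># L" | "j \<in># B" by auto
    then show ?thesis
    proof cases
      case 1
      then obtain L' where "L = add_mset j L'" by (metis multi_member_split)
      then show ?thesis using that(1) L LB by simp
    next
      case 2
      then obtain L' where "B = add_mset j L'" by (metis multi_member_split)
      then show ?thesis using that(3) L LB by simp
    qed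
  next
    case 2
    then obtain L where L: "B = add_mset i L" by (metis multi_member_split)
    then have LB: "A + L = add_mset j K" using assms by simp
    then have "j \<in># A + L" by simp
    then consider "j \<in># A" | "j \<in># L" by auto
    then show ?thesis
    proof cases
      case 1
      then obtain L' where "A = add_mset j L'" by (metis multi_member_split)
      then show ?thesis using that(4) L LB by simp
    next
      case 2
      then obtain L' where "L = add_mset j L'" by (metis multi_member_split)
      then show ?thesis using that(2) L LB by simp
    qed
  qed
qed

lemma Tau_step_comm:
  "flat P = add_mset i (add_mset j K) \<Longrightarrow> item_act i (Act (In a)) I \<Longrightarrow> item_act j (Act (Out a)) J \<Longrightarrow>
    \<exists>P'. step P Tau P' \<and> flat P' = I + J + K"
proof (induction P arbitrary: K rule: proc_induct)
  case (Par P Q)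
  from Par.prems have "flat P + flat Q = add_mset i (add_mset j K)" by simp
  then show ?case
  proof (cases rule: add_mset_two_cases)
    case (1 L)
    with Par obtain P' where "step P Tau P'" "flat P' = I + J + L" by blast
    with 1 show ?thesis by (intro exI[of _ "Par P' Q"]) (auto intro: step.par_left)
  next
    case (2 L)
    with Par obtain Q' where "step Q Tau Q'" "flat Q' = I + J + L" by blast
    with 2 show ?thesis by (intro exI[of _ "Par P Q'"]) (auto intro: step.par_right)
  next
    case (3 L L')
    obtain P' Q' where "step P (Pre (Act (In a))) P'" "flat P' = I + L"
      "step Q (Pre (Act (Out a))) Q'" "flat Q' = J + L'"
      using Pre_step 3 Par.prems by metis
    with 3 show ?thesis by (intro exI[of _ "Par P' Q'"]) (auto intro: step.comm_left)
  next
    case (4 L L')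
    obtain P' Q' where "step P (Pre (Act (Out a))) P'" "flat P' = J + L"
      "step Q (Pre (Act (In a))) Q'" "flat Q' = I + L'"
      using Pre_step 4 Par.prems by metis
    with 4 show ?thesis by (intro exI[of _ "Par P' Q'"]) (auto intro: step.comm_right)
  qed
qed (auto split: if_splits)

lemma Tau_step_upd:
  "flat P = add_mset i (add_mset j K) \<Longrightarrow> item_act i (Upd a U) I \<Longrightarrow> item_upd j a U J \<Longrightarrow>
    star_free P \<Longrightarrow> \<exists>P'. step P Tau P' \<and> flat P' = I + J + K"
proof (induction P arbitrary: K rule: proc_induct)
  case (Par P Q)
  from Par.prems have "flat P + flat Q = add_mset i (add_mset j K)" by simp
  then show ?case
  proof (cases rule: add_mset_two_cases)
    case (1 L)
    with Par obtain P' where "step P Tau P'" "flat P' = I + J + L" by fastforce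
    with 1 show ?thesis by (intro exI[of _ "Par P' Q"]) (auto intro: step.par_left)
  next
    case (2 L)
    with Par obtain Q' where "step Q Tau Q'" "flat Q' = I + J + L" by fastforce
    with 2 show ?thesis by (intro exI[of _ "Par P Q'"]) (auto intro: step.par_right)
  next
    case (3 L L')
    obtain P' where "step P (Pre (Upd a U)) P'" "flat P' = I + L"
      using Pre_step 3 Par.prems by metis
    moreover obtain R Q' where "step Q (Offer a R) Q'" "flat (subst_star (fill U R) Q') = J + L'"
      using Offer_step[of Q j L' a U J] 3 Par.prems by auto
    ultimately show ?thesis using 3
      by (intro exI[of _ "Par P' (subst_star (fill U R) Q')"]) (auto intro: step.update_right)
  next
    case (4 L L')
    obtain Q' where "step Q (Pre (Upd a U)) Q'" "flat Q' = I + L'"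
      using Pre_step 4 Par.prems by metis
    moreover obtain R P' where "step P (Offer a R) P'" "flat (subst_star (fill U R) P') = J + L"
      using Offer_step[of P j L a U J] 4 Par.prems by auto
    ultimately show ?thesis using 4
      by (intro exI[of _ "Par (subst_star (fill U R) P') Q'"]) (auto intro: step.update_left)
  qed
qed (auto split: if_splits)

lemma Tau_step:
  assumes "soup_tau M M'" "flat P = M" "star_free P"
  shows "\<exists>P'. step P Tau P' \<and> flat P' = M'"
  using assms
proof (induction arbitrary: P rule: soup_tau.induct)
  case (comm i a I j J K)
  then show ?case using Tau_step_comm by blast
next
  case (upd i a U I j J K)
  then show ?case using Tau_step_upd by blast
next
  case (box M M' a K)
  note IH = box.IH
  from box.prems show ?case
  \<comment> \<open>The outer induction follows the nesting of locations; the inner one searches the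
    parallel compositions for the location in which the reduction takes place.\<close>
  proof (induction P arbitrary: K rule: proc_induct)
    case (Loc b P)
    with IH[of P] show ?case by (fastforce intro: step.loc)
  next
    case (Par P Q)
    then have "Box a M \<in># flat P + flat Q" by simp
    then consider "Box a M \<in># flat P" | "Box a M \<in># flat Q" by auto
    then show ?case
    proof cases
      case 1
      then obtain L where L: "flat P = add_mset (Box a M) L" by (metis multi_member_split)
      with Par obtain P' where "step P Tau P'" "flat P' = add_mset (Box a M') L" by fastforce
      then show ?thesis using L Par.prems
        by (intro exI[of _ "Par P' Q"]) (auto intro: step.par_left)
    next
      case 2
      then obtain L where L: "flat Q = add_mset (Box a M) L" by (metis multi_member_split)
      with Par obtain Q' where "step Q Tau Q'" "flat Q' = add_mset (Box a M') L" by fastforce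
      then show ?thesis using L Par.prems
        by (intro exI[of _ "Par P Q'"]) (auto intro: step.par_right)
    qed
  qed (auto split: if_splits)
qed

lemma reduces_flat: "reduces P P' \<Longrightarrow> star_free P \<Longrightarrow> soup_tau (flat P) (flat P') \<and> star_free P'"
  using step_Tau reduces_def by blast

lemma soup_tau_reduces:
  assumes "soup_tau (flat P) M" "star_free P"
  obtains P' where "reduces P P'" "flat P' = M" "star_free P'"
  using Tau_step[OF assms(1) refl assms(2)] assms(2) reduces_flat reduces_def by blast

section \<open>Register machines as processes\<close>

datatype instr = Inc nat nat | DecJz nat nat nat

type_synonym program = "(nat \<times> instr) list"

fun effect :: "instr \<Rightarrow> (nat \<Rightarrow> nat) \<Rightarrow> nat \<times> (nat \<Rightarrow> nat)" where
  "effect (Inc r l) s = (l, s(r := Suc (s r)))"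
| "effect (DecJz r l l') s = (if s r > 0 then (l, s(r := s r - 1)) else (l', s))"

fun instr_reg :: "instr \<Rightarrow> nat" where
  "instr_reg (Inc r l) = r"
| "instr_reg (DecJz r l l') = r"

text \<open>A resource consumed by one input. Channels 0 and 1 are reserved for fuel and ash, so the
  channel of a label is shifted by 2.\<close>

definition token :: "name \<Rightarrow> proc" where
  "token a = Sum [(Act (Out a), Nil_proc)]"

abbreviation fuel :: proc where "fuel \<equiv> token 0"
abbreviation ash :: proc where "ash \<equiv> token 1"
abbreviation tok :: "nat \<Rightarrow> proc" where "tok l \<equiv> token (l + 2)"

text \<open>Three disjoint families of location names, all of them avoiding 0, the name of dead
  locks.\<close>

definition ctr_loc :: "nat \<Rightarrow> name" where "ctr_loc r = 3 * r + 1"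
definition lock_loc :: "nat \<Rightarrow> name" where "lock_loc r = 3 * r + 2"
definition open_loc :: "nat \<Rightarrow> name" where "open_loc r = 3 * r + 3"

lemma loc_neq [simp]:
  "ctr_loc r = ctr_loc r' \<longleftrightarrow> r = r'" "lock_loc r = lock_loc r' \<longleftrightarrow> r = r'"
  "open_loc r = open_loc r' \<longleftrightarrow> r = r'"
  "ctr_loc r \<noteq> lock_loc r'" "lock_loc r' \<noteq> ctr_loc r"
  "ctr_loc r \<noteq> open_loc r'" "open_loc r' \<noteq> ctr_loc r"
  "lock_loc r \<noteq> open_loc r'" "open_loc r' \<noteq> lock_loc r"
  "ctr_loc r \<noteq> 0" "lock_loc r \<noteq> 0" "open_loc r \<noteq> 0"
  "0 \<noteq> ctr_loc r" "0 \<noteq> lock_loc r" "0 \<noteq> open_loc r"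
  unfolding ctr_loc_def lock_loc_def open_loc_def by presburger+

definition unit :: "nat \<Rightarrow> proc" where
  "unit r = Sum [(Upd (open_loc r) (ULoc (lock_loc r) Hole), Nil_proc)]"

text \<open>Renaming the lock to itself changes nothing; it only checks that a unit has closed the
  lock again. The two ashes repay the burnt fuel and the consumed unit.\<close>

definition await_dec :: "nat \<Rightarrow> nat \<Rightarrow> proc" where
  "await_dec r l =
    Sum [(Upd (lock_loc r) (ULoc (lock_loc r) Hole), Par (tok l) (Par ash ash))]"

text \<open>The single ash repays the burnt fuel. Buried units are not repaid, and this loss is what
  limits the number of wrong zero tests.\<close>

definition reset :: "nat \<Rightarrow> nat \<Rightarrow> proc" where
  "reset r l =
    Sum [(Upd (ctr_loc r) (ULoc (ctr_loc r) (ULoc (lock_loc r) Hole)), Par (tok l) ash)]"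

fun exec_instr :: "instr \<Rightarrow> proc" where
  "exec_instr (Inc r l) =
    Sum [(Upd (ctr_loc r) (ULoc (ctr_loc r) (UPar Hole (unit r))), tok l)]"
| "exec_instr (DecJz r l l') =
    Sum [(Upd (lock_loc r) (ULoc (open_loc r) Hole), await_dec r l),
      (Upd (lock_loc r) (ULoc 0 Hole), reset r l')]"

definition burn :: "instr \<Rightarrow> proc" where
  "burn i = Sum [(Act (In 0), exec_instr i)]"

definition instr_proc :: "nat \<times> instr \<Rightarrow> proc" where
  "instr_proc = (\<lambda>(l, i). Bang (Act (In (l + 2))) (burn i))"

definition recycle :: "nat \<Rightarrow> proc" where
  "recycle h = Sum [(Act (In 1), Par fuel (tok h))]"

text \<open>Both servers listen at the halting label: ash may be recycled any number of times before
  the restart, or not at all.\<close>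

definition restart_procs :: "nat \<Rightarrow> nat \<Rightarrow> proc list" where
  "restart_procs h st = [Bang (Act (In (h + 2))) (recycle h), Bang (Act (In (h + 2))) (tok st)]"

text \<open>\<open>DecW\<close> and \<open>DecA\<close> are the same process before and after a unit
  has answered; only the name of the lock tells them apart.\<close>

datatype ctl = Tok nat | Want instr | Do instr | DecW nat nat | DecA nat nat | ZeroW nat nat | Back

fun ctl_proc :: "nat \<Rightarrow> ctl \<Rightarrow> proc" where
  "ctl_proc h (Tok l) = tok l"
| "ctl_proc h (Want i) = burn i"
| "ctl_proc h (Do i) = exec_instr i"
| "ctl_proc h (DecW r l) = await_dec r l"
| "ctl_proc h (DecA r l) = await_dec r l"
| "ctl_proc h (ZeroW r l) = reset r l"
| "ctl_proc h Back = recycle h"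

fun lock_name :: "ctl \<Rightarrow> nat \<Rightarrow> name" where
  "lock_name (DecW r l) r' = (if r = r' then open_loc r else lock_loc r')"
| "lock_name (ZeroW r l) r' = (if r = r' then 0 else lock_loc r')"
| "lock_name _ r' = lock_loc r'"

text \<open>The units lost in successive resets of a register.\<close>

fun garbage :: "nat \<Rightarrow> nat list \<Rightarrow> item multiset" where
  "garbage r [] = {#}"
| "garbage r (n # ns) = add_mset (Box 0 (garbage r ns)) (replicate_mset n (Thr (unit r)))"

definition reg_content :: "nat \<Rightarrow> nat \<Rightarrow> nat \<Rightarrow> nat list \<Rightarrow> item multiset" where
  "reg_content a r n ns = add_mset (Box a (garbage r ns)) (replicate_mset n (Thr (unit r)))"

definition reg :: "nat \<Rightarrow> nat \<Rightarrow> nat \<Rightarrow> nat list \<Rightarrow> item" where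
  "reg a r n ns = Box (ctr_loc r) (reg_content a r n ns)"

definition regs :: "nat set \<Rightarrow> ctl \<Rightarrow> (nat \<Rightarrow> nat) \<Rightarrow> (nat \<Rightarrow> nat list) \<Rightarrow> item multiset" where
  "regs R q s g = image_mset (\<lambda>r. reg (lock_name q r) r (s r) (g r)) (mset_set R)"

text \<open>
  The components are the control, the amounts of fuel and ash, and for each register its value and
  its garbage.
\<close>

type_synonym config = "ctl \<times> nat \<times> nat \<times> (nat \<Rightarrow> nat) \<times> (nat \<Rightarrow> nat list)"

definition server :: "program \<Rightarrow> nat \<Rightarrow> nat \<Rightarrow> item multiset" where
  "server prog h st = image_mset Thr (mset (map instr_proc prog @ restart_procs h st))"

fun soup :: "program \<Rightarrow> nat \<Rightarrow> nat \<Rightarrow> nat \<Rightarrow> config \<Rightarrow> item multiset" where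
  "soup prog h st k (q, nf, nb, s, g) =
    add_mset (Thr (ctl_proc h q)) (server prog h st + replicate_mset nf (Thr fuel) +
      replicate_mset nb (Thr ash) + regs {..<k} q s g)"

text \<open>\<open>dec\<close> and \<open>jz\<close> are both enabled whatever the register holds. A
  wrong \<open>dec\<close> ends in a \<open>DecW\<close> without successor; a wrong
  \<open>jz\<close> is punished only later, by \<open>reset\<close>.\<close>

inductive astep :: "program \<Rightarrow> nat \<Rightarrow> nat \<Rightarrow> config \<Rightarrow> config \<Rightarrow> bool" for prog h st where
  fetch: "(l, i) \<in> set prog \<Longrightarrow> astep prog h st (Tok l, nf, nb, s, g) (Want i, nf, nb, s, g)"
| recycle: "astep prog h st (Tok h, nf, nb, s, g) (Back, nf, nb, s, g)"
| restart: "astep prog h st (Tok h, nf, nb, s, g) (Tok st, nf, nb, s, g)"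
| burn: "astep prog h st (Want i, Suc nf, nb, s, g) (Do i, nf, nb, s, g)"
| inc: "astep prog h st (Do (Inc r l), nf, nb, s, g) (Tok l, nf, nb, s(r := Suc (s r)), g)"
| dec: "astep prog h st (Do (DecJz r l l'), nf, nb, s, g) (DecW r l, nf, nb, s, g)"
| jz: "astep prog h st (Do (DecJz r l l'), nf, nb, s, g) (ZeroW r l', nf, nb, s, g)"
| unit: "s r > 0 \<Longrightarrow>
    astep prog h st (DecW r l, nf, nb, s, g) (DecA r l, nf, nb, s(r := s r - 1), g)"
| ack: "astep prog h st (DecA r l, nf, nb, s, g) (Tok l, nf, Suc (Suc nb), s, g)"
| reset: "astep prog h st (ZeroW r l, nf, nb, s, g)
    (Tok l, nf, Suc nb, s(r := 0), g(r := s r # g r))"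
| refuel: "astep prog h st (Back, nf, Suc nb, s, g) (Tok h, Suc nf, nb, s, g)"

fun ctl_reg :: "ctl \<Rightarrow> nat set" where
  "ctl_reg (Tok l) = {}"
| "ctl_reg (Want i) = {instr_reg i}"
| "ctl_reg (Do i) = {instr_reg i}"
| "ctl_reg (DecW r l) = {r}"
| "ctl_reg (DecA r l) = {r}"
| "ctl_reg (ZeroW r l) = {r}"
| "ctl_reg Back = {}"

definition prog_regs :: "program \<Rightarrow> nat set" where
  "prog_regs prog = instr_reg ` snd ` set prog"

lemma regs_insert:
  "finite R \<Longrightarrow> r \<in> R \<Longrightarrow>
    regs R q s g = add_mset (reg (lock_name q r) r (s r) (g r)) (regs (R - {r}) q s g)"
  by (simp add: regs_def mset_set.remove)

lemma regs_cong:
  "(\<And>r. r \<in> R \<Longrightarrow> lock_name q r = lock_name q' r \<and> s r = s' r \<and> g r = g' r) \<Longrightarrow>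
    regs R q s g = regs R q' s' g'"
  unfolding regs_def by (cases "finite R") (auto intro!: image_mset_cong)

lemma in_regs: "finite R \<Longrightarrow> i \<in># regs R q s g \<longleftrightarrow>
    (\<exists>r\<in>R. i = reg (lock_name q r) r (s r) (g r))"
  by (auto simp: regs_def)

section \<open>Actions of the single threads and of the servers\<close>

lemma item_act_token: "item_act (Thr (token a)) p I \<longleftrightarrow> p = Act (Out a) \<and> I = {#}"
  by (auto simp: token_def item_act_thr_Sum)

lemma flat_token: "flat (token a) = {#Thr (token a)#}"
  by (simp add: token_def)

lemma item_act_unit: "item_act (Thr (unit r)) p I \<longleftrightarrow>
    p = Upd (open_loc r) (ULoc (lock_loc r) Hole) \<and> I = {#}"
  by (auto simp: unit_def item_act_thr_Sum)

lemma flat_unit: "flat (unit r) = {#Thr (unit r)#}"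
  by (simp add: unit_def)

lemma item_act_await_dec: "item_act (Thr (await_dec r l)) p I \<longleftrightarrow>
    p = Upd (lock_loc r) (ULoc (lock_loc r) Hole) \<and> I = {#Thr (tok l), Thr ash, Thr ash#}"
  by (auto simp: await_dec_def item_act_thr_Sum flat_token)

lemma flat_await_dec: "flat (await_dec r l) = {#Thr (await_dec r l)#}"
  by (simp add: await_dec_def)

lemma item_act_reset: "item_act (Thr (reset r l)) p I \<longleftrightarrow>
    p = Upd (ctr_loc r) (ULoc (ctr_loc r) (ULoc (lock_loc r) Hole)) \<and> I = {#Thr (tok l), Thr ash#}"
  by (auto simp: reset_def item_act_thr_Sum flat_token)

lemma flat_reset: "flat (reset r l) = {#Thr (reset r l)#}"
  by (simp add: reset_def)

lemma item_act_Inc: "item_act (Thr (exec_instr (Inc r l))) p I \<longleftrightarrow>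
    p = Upd (ctr_loc r) (ULoc (ctr_loc r) (UPar Hole (unit r))) \<and> I = {#Thr (tok l)#}"
  by (auto simp: item_act_thr_Sum flat_token)

lemma item_act_DecJz: "item_act (Thr (exec_instr (DecJz r l l'))) p I \<longleftrightarrow>
    p = Upd (lock_loc r) (ULoc (open_loc r) Hole) \<and> I = {#Thr (await_dec r l)#} \<or>
    p = Upd (lock_loc r) (ULoc 0 Hole) \<and> I = {#Thr (reset r l')#}"
  by (auto simp: item_act_thr_Sum flat_await_dec flat_reset)

lemma flat_exec_instr: "flat (exec_instr i) = {#Thr (exec_instr i)#}"
  by (cases i) simp_all

lemma item_act_burn: "item_act (Thr (burn i)) p I \<longleftrightarrow>
    p = Act (In 0) \<and> I = {#Thr (exec_instr i)#}"
  by (auto simp: burn_def item_act_thr_Sum flat_exec_instr)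

lemma flat_burn: "flat (burn i) = {#Thr (burn i)#}"
  by (simp add: burn_def)

lemma item_act_recycle: "item_act (Thr (recycle h)) p I \<longleftrightarrow>
    p = Act (In 1) \<and> I = {#Thr fuel, Thr (tok h)#}"
  by (auto simp: recycle_def item_act_thr_Sum flat_token)

lemma flat_recycle: "flat (recycle i) = {#Thr (recycle i)#}"
  by (simp add: recycle_def)

lemmas item_act_simps = item_act_token item_act_unit item_act_await_dec item_act_reset
  item_act_Inc item_act_DecJz item_act_burn item_act_recycle

declare exec_instr.simps [simp del]

lemma server_act:
  assumes "i \<in># server prog h st" "item_act i p I"
  obtains l ins where "(l, ins) \<in> set prog" "p = Act (In (l + 2))" "I = {#i, Thr (burn ins)#}"
  | "p = Act (In (h + 2))" "I = {#i, Thr (recycle h)#}"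
  | "p = Act (In (h + 2))" "I = {#i, Thr (tok st)#}"
proof -
  from assms(1) consider l ins where "(l, ins) \<in> set prog" "i = Thr (instr_proc (l, ins))"
    | "i = Thr (Bang (Act (In (h + 2))) (recycle h))"
    | "i = Thr (Bang (Act (In (h + 2))) (tok st))"
    by (auto simp: server_def restart_procs_def)
  then show thesis
    using assms(2) that
    by cases (auto simp: instr_proc_def item_act_thr_Bang flat_burn flat_recycle flat_token)
qed

lemma server_thr: "i \<in># server prog h st \<Longrightarrow> \<not> item_upd i a U I"
  by (auto simp: server_def)

lemma server_actI:
  "(l, ins) \<in> set prog \<Longrightarrow> \<exists>i K. server prog h st = add_mset i K \<and>
    item_act i (Act (In (l + 2))) {#i, Thr (burn ins)#}"
  "\<exists>i K. server prog h st = add_mset i K \<and> item_act i (Act (In (h + 2))) {#i, Thr (recycle h)#}"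
  "\<exists>i K. server prog h st = add_mset i K \<and> item_act i (Act (In (h + 2))) {#i, Thr (tok st)#}"
proof -
  have *: "\<exists>i K. server prog h st = add_mset i K \<and> item_act i p (I i)"
    if "i \<in># server prog h st" "item_act i p (I i)" for i p I
    using that by (metis multi_member_split)
  show "(l, ins) \<in> set prog \<Longrightarrow> \<exists>i K. server prog h st = add_mset i K \<and>
    item_act i (Act (In (l + 2))) {#i, Thr (burn ins)#}"
    by (rule *[of "Thr (instr_proc (l, ins))"])
      (auto simp: server_def instr_proc_def item_act_thr_Bang flat_burn)
  show "\<exists>i K. server prog h st = add_mset i K \<and> item_act i (Act (In (h + 2))) {#i, Thr (recycle h)#}"
    by (rule *[of "Thr (Bang (Act (In (h + 2))) (recycle h))"])
      (auto simp: server_def restart_procs_def item_act_thr_Bang flat_recycle)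
  show "\<exists>i K. server prog h st = add_mset i K \<and> item_act i (Act (In (h + 2))) {#i, Thr (tok st)#}"
    by (rule *[of "Thr (Bang (Act (In (h + 2))) (tok st))"])
      (auto simp: server_def restart_procs_def item_act_thr_Bang flat_token)
qed

section \<open>Inertness of the garbage and behaviour of one register\<close>

lemma garbage_act: "i \<in># garbage r ns \<Longrightarrow> item_act i p I \<Longrightarrow>
    p = Upd (open_loc r) (ULoc (lock_loc r) Hole)"
proof (induction ns arbitrary: i I)
  case (Cons n ns)
  from Cons.prems(1) consider "i = Thr (unit r)" | "i = Box 0 (garbage r ns)"
    by (auto split: if_splits)
  then show ?case
  proof cases
    case 2
    with Cons.prems(2) obtain j K J where "garbage r ns = add_mset j K" "item_act j p J"
      by (auto simp: item_act_Box)
    then show ?thesis using Cons.IH by auto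
  qed (use Cons.prems(2) in \<open>auto simp: item_act_unit\<close>)
qed simp

lemma garbage_upd: "i \<in># garbage r ns \<Longrightarrow> item_upd i a U I \<Longrightarrow> a = 0"
proof (induction ns arbitrary: i I)
  case (Cons n ns)
  from Cons.prems consider "i = Box 0 (garbage r ns)"
    by (auto split: if_splits)
  then show ?case
  proof cases
    case 1
    with Cons.prems(2) consider "a = 0" |
      j K J where "garbage r ns = add_mset j K" "item_upd j a U J"
      by (auto simp: item_upd_Box)
    then show ?thesis using Cons.IH by cases auto
  qed
qed simp

lemma garbage_box_upd:
  assumes "item_upd (Box a (garbage r ns)) b U J" "b \<noteq> 0"
  shows "a = b \<and> J = flat_upat U (garbage r ns)"
proof -
  from assms(1) consider "a = b \<and> J = flat_upat U (garbage r ns)"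
    | i K L where "garbage r ns = add_mset i K" "item_upd i b U L"
    unfolding item_upd_Box by blast
  then show ?thesis
  proof cases
    case 2
    then show ?thesis using garbage_upd[of i r ns b U L] assms(2) by simp
  qed
qed

text \<open>Buried units can still act through all the dead locks around them, but they ask for
  \<open>open_loc r\<close>, whereas every buried location is named 0.\<close>

lemma garbage_tau: "\<not> soup_tau (garbage r ns) M'"
proof (induction ns arbitrary: M')
  case (Cons n ns)
  show ?case
  proof
    assume "soup_tau (garbage r (n # ns)) M'"
    then show False
    proof cases
      case (comm i a I j J K)
      then have "i \<in># garbage r (n # ns)" by simp
      from garbage_act[OF this comm(3)] show False by simp
    next
      case (upd i a U I j J K)
      then have ij: "i \<in># garbage r (n # ns)" "j \<in># garbage r (n # ns)" by simp_all
      from garbage_act[OF ij(1) upd(3)] garbage_upd[OF ij(2) upd(4)] show False by simp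
    next
      case (box M M'' a K)
      then have "Box a M \<in># garbage r (n # ns)" by simp
      then have "M = garbage r ns" by (auto split: if_splits)
      with box Cons show False by simp
    qed
  qed
next
  case Nil
  show ?case by (auto elim: soup_tau.cases)
qed

lemma reg_act: "item_act (reg a r n ns) p I \<Longrightarrow> p = Upd (open_loc r) (ULoc (lock_loc r) Hole)"
proof -
  assume "item_act (reg a r n ns) p I"
  then obtain i K J where i: "reg_content a r n ns = add_mset i K" and act: "item_act i p J"
    by (auto simp: reg_def item_act_Box)
  then have "i \<in># reg_content a r n ns" by simp
  then consider "i = Thr (unit r)" | "i = Box a (garbage r ns)"
    by (auto simp: reg_content_def split: if_splits)
  then show ?thesis
  proof cases
    case 2
    with act obtain j K J where "garbage r ns = add_mset j K" "item_act j p J"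
      by (auto simp: item_act_Box)
    then show ?thesis using garbage_act[of j r ns p J] by simp
  qed (use act in \<open>auto simp: item_act_unit\<close>)
qed

lemma reg_upd:
  assumes "item_upd (reg a r n ns) b U I" "b \<noteq> 0"
  shows "b = ctr_loc r \<and> I = flat_upat U (reg_content a r n ns) \<or>
    b = a \<and> I = {#Box (ctr_loc r)
      (flat_upat U (garbage r ns) + replicate_mset n (Thr (unit r)))#}"
proof -
  from assms(1) consider "b = ctr_loc r" "I = flat_upat U (reg_content a r n ns)"
    | i K J where "reg_content a r n ns = add_mset i K" "item_upd i b U J"
      "I = {#Box (ctr_loc r) (J + K)#}"
    by (auto simp: reg_def item_upd_Box)
  then show ?thesis
  proof cases
    case 2
    then have "i \<in># reg_content a r n ns" by simp
    with 2(2) have i: "i = Box a (garbage r ns)"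
      unfolding reg_content_def by (auto split: if_splits)
    with 2 garbage_box_upd assms(2) have "a = b" "J = flat_upat U (garbage r ns)" by blast+
    moreover from 2(1) i have "K = replicate_mset n (Thr (unit r))" by (simp add: reg_content_def)
    ultimately show ?thesis using 2 by simp
  qed simp
qed

text \<open>The target must be the lock, as units are threads and buried locations are dead. The
  acting item must then be a unit beside the lock: a unit inside belongs to the same item as its
  target, and a reduction needs two items.\<close>

lemma reg_content_tau:
  assumes "soup_tau (reg_content a r n ns) M'"
  shows "a = open_loc r \<and> n > 0 \<and> M' = reg_content (lock_loc r) r (n - 1) ns"
  using assms
proof cases
  case (comm i b I j J K)
  then have "i \<in># reg_content a r n ns" by simp
  \<comment> \<open>The action is lifted to the whole register, where \<open>reg_act\<close> leaves
    only updates of the open lock.\<close>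
  then have "item_act (reg a r n ns) (Act (In b)) {#Box (ctr_loc r) (I + (reg_content a r n ns - {#i#}))#}"
    using comm(3) unfolding reg_def by (metis insert_DiffM item_act.box)
  then show ?thesis using reg_act by blast
next
  case (upd i b U I j J K)
  have i: "i \<in># reg_content a r n ns" "j \<in># reg_content a r n ns" using upd by simp_all
  then have "item_act (reg a r n ns) (Upd b U) {#Box (ctr_loc r) (I + (reg_content a r n ns - {#i#}))#}"
    using upd(3) unfolding reg_def by (metis insert_DiffM item_act.box)
  from reg_act[OF this] have b: "b = open_loc r" "U = ULoc (lock_loc r) Hole" by simp_all
  from i(2) upd(4) have j: "j = Box a (garbage r ns)"
    by (auto simp: reg_content_def split: if_splits)
  have J: "a = b" "J = {#Box (lock_loc r) (garbage r ns)#}"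
    using garbage_box_upd[of a r ns b U J] upd(4) j b by simp_all
  have iK: "add_mset i K = replicate_mset n (Thr (unit r))"
    using upd(1) j by (simp add: reg_content_def)
  then have "i \<in># replicate_mset n (Thr (unit r))" by (metis union_single_eq_member)
  then have "n > 0" "i = Thr (unit r)" by (auto split: if_splits)
  then obtain m where m: "n = Suc m" by (cases n) auto
  have "I = {#}" using upd(3) \<open>i = _\<close> by (simp add: item_act_unit)
  then show ?thesis using m iK J b upd(2) \<open>i = _\<close> by (simp add: reg_content_def)
next
  case (box M M'' b K)
  then have "Box b M \<in># reg_content a r n ns" by simp
  then have "M = garbage r ns" by (auto simp: reg_content_def split: if_splits)
  with box garbage_tau show ?thesis by blast
qed

text \<open>In these control states all locks are closed; \<open>Back\<close> serves as their common
  representative.\<close>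

lemma regs_ctl [simp]:
  "regs R (Tok l) s g = regs R Back s g"
  "regs R (Want i) s g = regs R Back s g"
  "regs R (Do i) s g = regs R Back s g"
  "regs R (DecA r l) s g = regs R Back s g"
  by (simp_all add: regs_def)

lemma regs_outside:
  assumes "finite R" "r \<in> R" "\<And>r'. r' \<noteq> r \<Longrightarrow> lock_name q r' = lock_loc r'"
    "s' = s(r := n)" "g' = g(r := ns)"
  shows "regs R q s' g' = add_mset (reg (lock_name q r) r n ns) (regs (R - {r}) Back s g)"
proof -
  have "regs (R - {r}) q s' g' = regs (R - {r}) Back s g"
    using assms by (intro regs_cong) simp
  then show ?thesis using regs_insert[OF assms(1,2), of q s' g'] assms(4,5) by simp
qed

lemma regs_at:
  assumes "finite R" "r \<in> R"
  shows "regs R Back (s(r := n)) (g(r := ns)) =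
      add_mset (reg (lock_loc r) r n ns) (regs (R - {r}) Back s g)"
    "regs R Back s g = add_mset (reg (lock_loc r) r (s r) (g r)) (regs (R - {r}) Back s g)"
    "regs R Back (s(r := n)) g = add_mset (reg (lock_loc r) r n (g r)) (regs (R - {r}) Back s g)"
    "regs R (DecW r l) s g =
      add_mset (reg (open_loc r) r (s r) (g r)) (regs (R - {r}) Back s g)"
    "regs R (ZeroW r l) s g = add_mset (reg 0 r (s r) (g r)) (regs (R - {r}) Back s g)"
proof -
  have *: "regs R q s g = add_mset (reg (lock_name q r) r (s r) (g r)) (regs (R - {r}) Back s g)"
    if "\<And>r'. r' \<noteq> r \<Longrightarrow> lock_name q r' = lock_loc r'" for q
    by (rule regs_outside[OF assms]) (use that in auto)
  show "regs R Back s g = add_mset (reg (lock_loc r) r (s r) (g r)) (regs (R - {r}) Back s g)"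
    "regs R (DecW r l) s g =
      add_mset (reg (open_loc r) r (s r) (g r)) (regs (R - {r}) Back s g)"
    "regs R (ZeroW r l) s g = add_mset (reg 0 r (s r) (g r)) (regs (R - {r}) Back s g)"
    using *[of Back] *[of "DecW r l"] *[of "ZeroW r l"] by simp_all
  show "regs R Back (s(r := n)) (g(r := ns)) =
      add_mset (reg (lock_loc r) r n ns) (regs (R - {r}) Back s g)"
    using regs_outside[OF assms, of Back _ s n _ g ns] by simp
  show "regs R Back (s(r := n)) g =
      add_mset (reg (lock_loc r) r n (g r)) (regs (R - {r}) Back s g)"
    by (rule trans[OF regs_outside[OF assms, of Back _ s n _ g "g r"]]) auto
qed

lemma regs_upd_outside [simp]:
  "regs (R - {r}) q (s(r := n)) g = regs (R - {r}) q s g"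
  "regs (R - {r}) q s (g(r := ns)) = regs (R - {r}) q s g"
  unfolding regs_def by (cases "finite R"; auto intro!: image_mset_cong)+

lemma reg_upd_Inc: "item_upd (reg a r n ns) (ctr_loc r) (ULoc (ctr_loc r) (UPar Hole (unit r)))
    {#reg a r (Suc n) ns#}"
  unfolding reg_def item_upd_Box by (simp add: reg_content_def flat_unit)

lemma reg_upd_reset: "item_upd (reg 0 r n ns) (ctr_loc r)
    (ULoc (ctr_loc r) (ULoc (lock_loc r) Hole)) {#reg (lock_loc r) r 0 (n # ns)#}"
  unfolding reg_def item_upd_Box by (simp add: reg_content_def flat_unit)

lemma reg_upd_rename: "item_upd (reg a r n ns) a (ULoc b Hole) {#reg b r n ns#}"
  unfolding reg_def reg_content_def
  using item_upd.box[OF item_upd.here[of a "garbage r ns" "ULoc b Hole"]] by simp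

lemma unit_fires:
  assumes "n > 0"
  shows "soup_tau (reg_content (open_loc r) r n ns) (reg_content (lock_loc r) r (n - 1) ns)"
proof -
  obtain m where m: "n = Suc m" using assms by (cases n) auto
  have "soup_tau (add_mset (Thr (unit r)) (add_mset (Box (open_loc r) (garbage r ns))
      (replicate_mset m (Thr (unit r)))))
    ({#} + {#Box (lock_loc r) (garbage r ns)#} + replicate_mset m (Thr (unit r)))"
  proof (rule soup_tau.upd)
    show "item_act (Thr (unit r)) (Upd (open_loc r) (ULoc (lock_loc r) Hole)) {#}"
      by (simp add: item_act_unit)
    show "item_upd (Box (open_loc r) (garbage r ns)) (open_loc r) (ULoc (lock_loc r) Hole)
      {#Box (lock_loc r) (garbage r ns)#}"
      by (simp add: item_upd_Box)
  qed
  then show ?thesis by (simp add: reg_content_def m add_mset_commute)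
qed

section \<open>Reductions of the soup are exactly the steps of configurations\<close>

lemma soup_tau_commI:
  assumes "item_act i (Act (In a)) I" "item_act j (Act (Out a)) J"
    and "M = add_mset i (add_mset j K)" "M' = I + J + K"
  shows "soup_tau M M'"
  using soup_tau.comm[OF assms(1,2)] assms(3,4) by simp

lemma soup_tau_updI:
  assumes "item_act i (Upd a U) I" "item_upd j a U J"
    and "M = add_mset i (add_mset j K)" "M' = I + J + K"
  shows "soup_tau M M'"
  using soup_tau.upd[OF assms(1,2)] assms(3,4) by simp

text \<open>The bound ensures that the register addressed by the control is present in the
  soup.\<close>

lemma astep_soup_tau:
  assumes "astep prog h st c c'" "ctl_reg (fst c) \<subseteq> {..<k}"
  shows "soup_tau (soup prog h st k c) (soup prog h st k c')"
  using assms
proof (cases rule: astep.cases)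
  case (fetch l ins nf nb s g)
  from server_actI(1)[OF fetch(3)] obtain i K where i: "server prog h st = add_mset i K"
    "item_act i (Act (In (l + 2))) {#i, Thr (burn ins)#}" by blast
  have "item_act (Thr (tok l)) (Act (Out (l + 2))) {#}" by (simp add: item_act_token)
  from soup_tau.comm[OF i(2) this, of "K + replicate_mset nf (Thr fuel) +
      replicate_mset nb (Thr ash) + regs {..<k} Back s g"]
  show ?thesis by (simp add: fetch i(1) add_mset_commute)
next
  case (recycle nf nb s g)
  from server_actI(2) obtain i K where i: "server prog h st = add_mset i K"
    "item_act i (Act (In (h + 2))) {#i, Thr (recycle h)#}" by blast
  have "item_act (Thr (tok h)) (Act (Out (h + 2))) {#}" by (simp add: item_act_token)
  from soup_tau.comm[OF i(2) this, of "K + replicate_mset nf (Thr fuel) +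
      replicate_mset nb (Thr ash) + regs {..<k} Back s g"]
  show ?thesis by (simp add: recycle i(1) add_mset_commute)
next
  case (restart nf nb s g)
  from server_actI(3) obtain i K where i: "server prog h st = add_mset i K"
    "item_act i (Act (In (h + 2))) {#i, Thr (tok st)#}" by blast
  have "item_act (Thr (tok h)) (Act (Out (h + 2))) {#}" by (simp add: item_act_token)
  from soup_tau.comm[OF i(2) this, of "K + replicate_mset nf (Thr fuel) +
      replicate_mset nb (Thr ash) + regs {..<k} Back s g"]
  show ?thesis by (simp add: restart i(1) add_mset_commute)
next
  case (burn i nf nb s g)
  show ?thesis
    by (rule soup_tau_commI[of "Thr (burn i)" 0 "{#Thr (exec_instr i)#}" "Thr fuel" "{#}" _ "server prog h st +
        replicate_mset nf (Thr fuel) + replicate_mset nb (Thr ash) + regs {..<k} Back s g"])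
      (simp_all add: burn item_act_simps)
next
  case (inc r l nf nb s g)
  with assms have r: "r \<in> {..<k}" by simp
  show ?thesis
    by (rule soup_tau_updI[OF item_act_Inc[THEN iffD2, OF conjI, OF refl refl] reg_upd_Inc
          , where K = "server prog h st +
        replicate_mset nf (Thr fuel) + replicate_mset nb (Thr ash) + regs ({..<k} - {r}) Back s g"])
      (simp_all add: inc regs_at[OF _ r] add_mset_commute)
next
  case (dec r l l' nf nb s g)
  with assms have r: "r \<in> {..<k}" by simp
  show ?thesis
    by (rule soup_tau_updI[OF item_act_DecJz[THEN iffD2, OF disjI1, OF conjI, OF refl refl]
          reg_upd_rename
          , where K = "server prog h st +
        replicate_mset nf (Thr fuel) + replicate_mset nb (Thr ash) + regs ({..<k} - {r}) Back s g"])
      (simp_all add: dec regs_at[OF _ r] add_mset_commute)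
next
  case (jz r l l' nf nb s g)
  with assms have r: "r \<in> {..<k}" by simp
  show ?thesis
    by (rule soup_tau_updI[OF item_act_DecJz[THEN iffD2, OF disjI2, OF conjI, OF refl refl]
          reg_upd_rename
          , where K = "server prog h st +
        replicate_mset nf (Thr fuel) + replicate_mset nb (Thr ash) + regs ({..<k} - {r}) Back s g"])
      (simp_all add: jz regs_at[OF _ r] add_mset_commute)
next
  case (unit s r l nf nb g)
  with assms have r: "r \<in> {..<k}" by simp
  from soup_tau.box[OF unit_fires[OF unit(3)], of "ctr_loc r" r "g r"
      "add_mset (Thr (await_dec r l)) (server prog h st +
        replicate_mset nf (Thr fuel) + replicate_mset nb (Thr ash) + regs ({..<k} - {r}) Back s g)"]
  show ?thesis by (simp add: unit regs_at[OF _ r] add_mset_commute flip: reg_def)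
next
  case (ack r l nf nb s g)
  with assms have r: "r \<in> {..<k}" by simp
  show ?thesis
    by (rule soup_tau_updI[OF item_act_await_dec[THEN iffD2, OF conjI, OF refl refl]
          reg_upd_rename
          , where K = "server prog h st +
        replicate_mset nf (Thr fuel) + replicate_mset nb (Thr ash) + regs ({..<k} - {r}) Back s g"])
      (simp_all add: ack regs_at[OF _ r] add_mset_commute)
next
  case (reset r l nf nb s g)
  with assms have r: "r \<in> {..<k}" by simp
  show ?thesis
    by (rule soup_tau_updI[OF item_act_reset[THEN iffD2, OF conjI, OF refl refl]
          reg_upd_reset
          , where K = "server prog h st +
        replicate_mset nf (Thr fuel) + replicate_mset nb (Thr ash) + regs ({..<k} - {r}) Back s g"])
      (simp_all add: reset regs_at[OF _ r] add_mset_commute)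
next
  case (refuel nf nb s g)
  show ?thesis
    by (rule soup_tau_commI[of "Thr (recycle h)" 1 "{#Thr fuel, Thr (tok h)#}" "Thr ash" "{#}" _ "server prog h st +
        replicate_mset nf (Thr fuel) + replicate_mset nb (Thr ash) + regs {..<k} Back s g"])
      (simp_all add: refuel item_act_simps add_mset_commute)
qed

lemma ctl_act:
  assumes "item_act (Thr (ctl_proc h q)) p I"
  obtains l where "q = Tok l" "p = Act (Out (l + 2))" "I = {#}"
  | i where "q = Want i" "p = Act (In 0)" "I = {#Thr (exec_instr i)#}"
  | "q = Back" "p = Act (In 1)" "I = {#Thr fuel, Thr (tok h)#}"
  | r l where "q = Do (Inc r l)" "p = Upd (ctr_loc r) (ULoc (ctr_loc r) (UPar Hole (unit r)))"
    "I = {#Thr (tok l)#}"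
  | r l l' where "q = Do (DecJz r l l')" "p = Upd (lock_loc r) (ULoc (open_loc r) Hole)"
    "I = {#Thr (await_dec r l)#}"
  | r l l' where "q = Do (DecJz r l l')" "p = Upd (lock_loc r) (ULoc 0 Hole)"
    "I = {#Thr (reset r l')#}"
  | r l where "q = DecW r l \<or> q = DecA r l" "p = Upd (lock_loc r) (ULoc (lock_loc r) Hole)"
    "I = {#Thr (tok l), Thr ash, Thr ash#}"
  | r l where "q = ZeroW r l" "p = Upd (ctr_loc r) (ULoc (ctr_loc r) (ULoc (lock_loc r) Hole))"
    "I = {#Thr (tok l), Thr ash#}"
proof (cases q)
  case (Do i)
  with assms that(4-6) show ?thesis by (cases i) (auto simp: item_act_simps)
qed (use assms that(1-3,7-8) in \<open>auto simp: item_act_simps\<close>)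

lemma soup_cases:
  assumes "i \<in># soup prog h st k (q, nf, nb, s, g)"
  obtains "i = Thr (ctl_proc h q)" | "i \<in># server prog h st" | "i = Thr fuel" "nf > 0"
  | "i = Thr ash" "nb > 0" | r where "r < k" "i = reg (lock_name q r) r (s r) (g r)"
  using assms by (auto simp: in_regs split: if_splits)

text \<open>The partners determine the step. Outputs come only from the control token, fuel and ash,
  inputs only from servers and the control, and updates between items only from the control; inside
  a single register only a unit can fire.\<close>

lemma soup_tau_astep:
  assumes "soup_tau (soup prog h st k c) M'"
  shows "\<exists>c'. astep prog h st c c' \<and> M' = soup prog h st k c'"
proof -
  obtain q nf nb s g where c: "c = (q, nf, nb, s, g)" by (cases c)
  define S where "S = server prog h st"
  have ctl_eq: "add_mset j K = S + replicate_mset nf (Thr fuel) + replicate_mset nb (Thr ash) +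
      regs {..<k} q s g"
    if "soup prog h st k c = add_mset i (add_mset j K)" "i = Thr (ctl_proc h q)" for i j K
    using that by (simp add: c S_def)
  from assms show ?thesis
  proof cases
    case (comm i a I j J K)
    have "i \<in># soup prog h st k c" "j \<in># soup prog h st k c" using comm by simp_all
    note ij = this[unfolded c]
    from ij(2) consider l where "j = Thr (ctl_proc h q)" "q = Tok l" "a = l + 2" "J = {#}"
      | "j = Thr fuel" "a = 0" "nf > 0" "J = {#}" | "j = Thr ash" "a = 1" "nb > 0" "J = {#}"
    proof (cases rule: soup_cases)
      case 1
      with comm(4) that show ?thesis by (auto elim!: ctl_act)
    next
      case 2
      with comm(4) show ?thesis by (auto elim!: server_act)
    next
      case 5
      with comm(4) show ?thesis using reg_act by blast
    qed (use comm(4) that in \<open>simp_all add: item_act_token\<close>)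
    then show ?thesis
    proof cases
      case (1 l)
      then have iK: "add_mset i K = S + replicate_mset nf (Thr fuel) +
          replicate_mset nb (Thr ash) + regs {..<k} Back s g"
        using ctl_eq[of j i K] comm(1) by (simp add: add_mset_commute)
      from ij(1) show ?thesis
      proof (cases rule: soup_cases)
        case 2
        then obtain S' where S': "S = add_mset i S'" unfolding S_def by (metis multi_member_split)
        with iK have K: "K = S' + replicate_mset nf (Thr fuel) +
          replicate_mset nb (Thr ash) + regs {..<k} Back s g" by simp
        from 2 comm(3) show ?thesis
        proof (cases rule: server_act)
          case (1 l' ins)
          with \<open>a = l + 2\<close> have "(l, ins) \<in> set prog" by simp
          from astep.fetch[OF this] show ?thesis
            using \<open>q = Tok l\<close> \<open>J = {#}\<close> S'
            by (intro exI[of _ "(Want ins, nf, nb, s, g)"])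
              (auto simp: c comm(2) K 1 S_def add_mset_commute)
        next
          case 2
          with \<open>a = l + 2\<close> have "h = l" by simp
          then show ?thesis
            using \<open>q = Tok l\<close> \<open>J = {#}\<close> S'
            by (intro exI[of _ "(Back, nf, nb, s, g)"])
              (auto simp: c comm(2) K 2 S_def add_mset_commute intro: astep.recycle)
        next
          case 3
          with \<open>a = l + 2\<close> have "h = l" by simp
          then show ?thesis
            using \<open>q = Tok l\<close> \<open>J = {#}\<close> S'
            by (intro exI[of _ "(Tok st, nf, nb, s, g)"])
              (auto simp: c comm(2) K 3 S_def add_mset_commute intro: astep.restart)
        qed
      next
        case 1
        with comm(3) \<open>q = Tok l\<close> show ?thesis by (simp add: item_act_token)
      next
        case 5
        with comm(3) show ?thesis using reg_act by blast
      qed (use comm(3) in \<open>simp_all add: item_act_token\<close>)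
    next
      case 2
      have "i = Thr (ctl_proc h q) \<and> (\<exists>ins. q = Want ins \<and> I = {#Thr (exec_instr ins)#})"
        using ij(1)
      proof (cases rule: soup_cases)
        case 1
        from comm(3)[unfolded 1] show ?thesis
          by (cases rule: ctl_act) (use 1 \<open>a = 0\<close> in simp_all)
      next
        case 2
        then show ?thesis using comm(3) \<open>a = 0\<close> by (auto elim!: server_act)
      next
        case 5
        then show ?thesis using comm(3) reg_act by blast
      qed (use comm(3) in \<open>simp_all add: item_act_token\<close>)
      then obtain ins where ins: "i = Thr (ctl_proc h q)" "q = Want ins"
        "I = {#Thr (exec_instr ins)#}" by blast
      from 2 obtain m where m: "nf = Suc m" by (cases nf) auto
      have "add_mset j K = S + replicate_mset nf (Thr fuel) +
          replicate_mset nb (Thr ash) + regs {..<k} Back s g"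
        using ctl_eq[OF comm(1) ins(1)] ins(2) by simp
      then have "K = S + replicate_mset m (Thr fuel) +
          replicate_mset nb (Thr ash) + regs {..<k} Back s g"
        using m 2 by simp
      then show ?thesis using ins m 2
        by (intro exI[of _ "(Do ins, m, nb, s, g)"])
          (auto simp: c comm(2) S_def intro: astep.burn)
    next
      case 3
      have "i = Thr (ctl_proc h q) \<and> q = Back \<and> I = {#Thr fuel, Thr (tok h)#}"
        using ij(1)
      proof (cases rule: soup_cases)
        case 1
        from comm(3)[unfolded 1] show ?thesis
          by (cases rule: ctl_act) (use 1 \<open>a = 1\<close> in simp_all)
      next
        case 2
        then show ?thesis using comm(3) \<open>a = 1\<close> by (auto elim!: server_act)
      next
        case 5
        then show ?thesis using comm(3) reg_act by blast
      qed (use comm(3) in \<open>simp_all add: item_act_token\<close>)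
      then have ins: "i = Thr (ctl_proc h q)" "q = Back" "I = {#Thr fuel, Thr (tok h)#}" by blast+
      from 3 obtain m where m: "nb = Suc m" by (cases nb) auto
      have "add_mset j K = S + replicate_mset nf (Thr fuel) +
          replicate_mset nb (Thr ash) + regs {..<k} Back s g"
        using ctl_eq[OF comm(1) ins(1)] ins(2) by simp
      then have "K = S + replicate_mset nf (Thr fuel) +
          replicate_mset m (Thr ash) + regs {..<k} Back s g"
        using m 3 by simp
      then show ?thesis using ins m 3
        by (intro exI[of _ "(Tok h, Suc nf, m, s, g)"])
          (auto simp: c comm(2) S_def add_mset_commute intro: astep.refuel)
    qed
  next
    case (upd i a U I j J K)
    have "i \<in># soup prog h st k c" "j \<in># soup prog h st k c" using upd by simp_all
    note ij = this[unfolded c]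
    \<comment> \<open>No thread asks for location 0, so dead locks cannot be hit.\<close>
    have a: "a \<noteq> 0"
      using ij(1)
    proof (cases rule: soup_cases)
      case 1
      from upd(3)[unfolded 1] show ?thesis by (cases rule: ctl_act) simp_all
    next
      case 2
      with upd(3) show ?thesis by (auto elim!: server_act)
    next
      case 5
      with upd(3) show ?thesis using reg_act by fastforce
    qed (use upd(3) in \<open>auto simp: item_act_token\<close>)
    from ij(2) upd(4) obtain r where r: "r < k" "j = reg (lock_name q r) r (s r) (g r)"
      by (cases rule: soup_cases) (auto dest: server_thr)
    let ?R = "{..<k} - {r}"
    have rk: "finite {..<k}" "r \<in> {..<k}" using r by simp_all
    have J: "a = ctr_loc r \<and> J = flat_upat U (reg_content (lock_name q r) r (s r) (g r)) \<or>
        a = lock_name q r \<and> J = {#Box (ctr_loc r)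
          (flat_upat U (garbage r (g r)) + replicate_mset (s r) (Thr (unit r)))#}"
      using reg_upd[OF upd(4)[unfolded r(2)] a] .
    have i: "i = Thr (ctl_proc h q)"
      using ij(1)
    proof (cases rule: soup_cases)
      case 2
      with upd(3) show ?thesis by (auto elim!: server_act)
    next
      \<comment> \<open>A unit of \<open>r'\<close> acting from within its register needs the open
        lock of \<open>r'\<close>, which occurs only in that register. Both partners would be the
        same item, but the soup contains it just once.\<close>
      case (5 r')
      with upd(3) have a': "a = open_loc r'" using reg_act by blast
      from J a' have "lock_name q r = open_loc r'" by auto
      then have "r' = r" by (cases q) (auto split: if_splits)
      then have ji: "j = i" using 5 r by simp
      have "add_mset i (add_mset i K) = add_mset (Thr (ctl_proc h q)) (S +
          replicate_mset nf (Thr fuel) + replicate_mset nb (Thr ash) +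
          add_mset i (regs ?R q s g))"
        using upd(1) regs_insert[OF rk, of q s g] ji r by (simp add: c S_def)
      then have "add_mset i K = add_mset (Thr (ctl_proc h q)) (S +
          replicate_mset nf (Thr fuel) + replicate_mset nb (Thr ash) + regs ?R q s g)"
        by simp
      then have "i \<in># add_mset (Thr (ctl_proc h q)) (S +
          replicate_mset nf (Thr fuel) + replicate_mset nb (Thr ash) + regs ?R q s g)"
        by (metis union_single_eq_member)
      then show ?thesis
        using 5 \<open>r' = r\<close> by (auto simp: S_def server_def in_regs reg_def split: if_splits)
    qed (use upd(3) in \<open>auto simp: item_act_token\<close>)
    from ctl_eq[OF upd(1) i] regs_insert[OF rk, of q s g] r
    have K: "K = S + replicate_mset nf (Thr fuel) + replicate_mset nb (Thr ash) + regs ?R q s g"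
      by simp
    from upd(3) show ?thesis unfolding i
    proof (cases rule: ctl_act)
      case (4 r' l)
      with J have "r' = r" "J = flat_upat U (reg_content (lock_loc r) r (s r) (g r))" by auto
      with 4 K show ?thesis
        by (intro exI[of _ "(Tok l, nf, nb, s(r := Suc (s r)), g)"])
          (auto simp: c upd(2) S_def regs_at[OF rk] reg_def reg_content_def flat_unit
            add_mset_commute intro: astep.inc)
    next
      case (5 r' l l')
      with J have "r' = r" "J = {#Box (ctr_loc r)
          (flat_upat U (garbage r (g r)) + replicate_mset (s r) (Thr (unit r)))#}" by auto
      with 5 K show ?thesis
        by (intro exI[of _ "(DecW r l, nf, nb, s, g)"])
          (auto simp: c upd(2) S_def regs_at[OF rk] reg_def reg_content_def intro: astep.dec)
    next
      case (6 r' l l')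
      with J have "r' = r" "J = {#Box (ctr_loc r)
          (flat_upat U (garbage r (g r)) + replicate_mset (s r) (Thr (unit r)))#}" by auto
      with 6 K show ?thesis
        by (intro exI[of _ "(ZeroW r l', nf, nb, s, g)"])
          (auto simp: c upd(2) S_def regs_at[OF rk] reg_def reg_content_def intro: astep.jz)
    next
      \<comment> \<open>In \<open>DecW\<close> the lock is named \<open>open_loc r'\<close>, so the
        update finds no target; \<open>DecA\<close> remains.\<close>
      case (7 r' l)
      with J have *: "lock_name q r = lock_loc r'" "J = {#Box (ctr_loc r)
          (flat_upat U (garbage r (g r)) + replicate_mset (s r) (Thr (unit r)))#}"
        by auto
      from 7(1) *(1) have "r' = r" "q = DecA r l" by (auto split: if_splits)
      with 7 K * show ?thesis
        by (intro exI[of _ "(Tok l, nf, Suc (Suc nb), s, g)"])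
          (auto simp: c upd(2) S_def regs_at[OF rk] reg_def reg_content_def add_mset_commute
            intro: astep.ack)
    next
      case (8 r' l)
      have "lock_name q r \<noteq> ctr_loc r'" using 8(1) by auto
      with J 8 have "r' = r" "J = flat_upat U (reg_content (lock_name q r) r (s r) (g r))" by auto
      then have "r' = r" "J = flat_upat U (reg_content 0 r (s r) (g r))" using 8(1) by simp_all
      moreover from this 8 K have "K = S + replicate_mset nf (Thr fuel) +
          replicate_mset nb (Thr ash) + regs ?R Back s g"
        by (auto intro: regs_cong)
      ultimately show ?thesis using 8
        by (intro exI[of _ "(Tok l, nf, Suc nb, s(r := 0), g(r := s r # g r))"])
          (auto simp: c upd(2) S_def regs_at[OF rk] reg_def reg_content_def add_mset_commute
            intro: astep.reset)
    qed simp_all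
  next
    case (box M M'' a K)
    then have "Box a M \<in># soup prog h st k (q, nf, nb, s, g)" by (simp add: c)
    then obtain r where r: "r < k" "Box a M = reg (lock_name q r) r (s r) (g r)"
      by (cases rule: soup_cases) (auto simp: server_def)
    let ?R = "{..<k} - {r}"
    have rk: "finite {..<k}" "r \<in> {..<k}" using r by simp_all
    from r have aM: "a = ctr_loc r" "M = reg_content (lock_name q r) r (s r) (g r)"
      by (simp_all add: reg_def)
    with box reg_content_tau have t: "lock_name q r = open_loc r" "s r > 0"
      "M'' = reg_content (lock_loc r) r (s r - 1) (g r)" by blast+
    then obtain l where q: "q = DecW r l" by (cases q) (auto split: if_splits)
    have "K = add_mset (Thr (ctl_proc h q)) (S + replicate_mset nf (Thr fuel) +
        replicate_mset nb (Thr ash) + regs ?R q s g)"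
      using box(1) r(2) regs_insert[OF rk, of q s g] by (auto simp: c S_def add.assoc)
    moreover have "regs ?R q s g = regs ?R Back s g" using q by (auto intro: regs_cong)
    ultimately show ?thesis using q t(2,3) aM
      by (intro exI[of _ "(DecA r l, nf, nb, s(r := s r - 1), g)"])
        (auto simp: c box(2) S_def regs_at[OF rk] reg_def add_mset_commute intro: astep.unit[simplified])
  qed
qed

section \<open>Infinite runs of configurations against runs of the reliable machine\<close>

definition mstep :: "program \<Rightarrow> nat \<times> (nat \<Rightarrow> nat) \<Rightarrow> nat \<times> (nat \<Rightarrow> nat) \<Rightarrow> bool" where
  "mstep prog c c' \<longleftrightarrow> (\<exists>i. (fst c, i) \<in> set prog \<and> c' = effect i (snd c))"

definition within :: "nat \<Rightarrow> (nat \<Rightarrow> nat) \<Rightarrow> bool" where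
  "within k s \<longleftrightarrow> (\<forall>r\<ge>k. s r = 0)"

text \<open>Every state from which \<open>X\<close> can be reached has a successor of the same kind,
  because a path into \<open>X\<close> can be prolonged by a nonempty one.\<close>

lemma chain_exists:
  assumes "R\<^sup>*\<^sup>* c x" "x \<in> X" "\<And>x. x \<in> X \<Longrightarrow> \<exists>y\<in>X. R\<^sup>+\<^sup>+ x y"
  obtains \<sigma> :: "nat \<Rightarrow> 'a" where "\<sigma> 0 = c" "\<And>i. R (\<sigma> i) (\<sigma> (Suc i))"
proof -
  define Y where "Y = {z. \<exists>x\<in>X. R\<^sup>*\<^sup>* z x}"
  have step: "\<exists>z'. z' \<in> Y \<and> R z z'" if "z \<in> Y" for z
  proof -
    from that obtain x where x: "x \<in> X" "R\<^sup>*\<^sup>* z x" by (auto simp: Y_def)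
    from assms(3)[OF x(1)] obtain y where y: "y \<in> X" "R\<^sup>+\<^sup>+ x y" by blast
    with x(2) have "R\<^sup>+\<^sup>+ z y" by (metis rtranclp_tranclp_tranclp)
    then show ?thesis using y(1) by (auto simp: Y_def dest!: tranclpD)
  qed
  have "c \<in> Y" using assms(1,2) by (auto simp: Y_def)
  then obtain \<sigma> where "\<sigma> 0 = c" "\<And>i. \<sigma> i \<in> Y \<and> R (\<sigma> i) (\<sigma> (Suc i))"
    using dependent_nat_choice[of "\<lambda>n z. z \<in> Y \<and> (n = 0 \<longrightarrow> z = c)" "\<lambda>n z z'. R z z'"] step
    by (metis nat.distinct(1))
  with that show thesis by blast
qed

text \<open>Distinct labels make the reliable machine deterministic. No instruction sits at
  \<open>h\<close>, so a token there can only recycle or restart.\<close>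

locale machine =
  fixes prog :: program and h st k :: nat
  assumes det: "distinct (map fst prog)"
    and h: "h \<notin> fst ` set prog"
    and regs: "prog_regs prog \<subseteq> {..<k}"
begin

lemma mstep_unique: "mstep prog c d \<Longrightarrow> mstep prog c d' \<Longrightarrow> d = d'"
  using det unfolding mstep_def by (metis eq_key_imp_eq_value)

text \<open>By determinism, of two runs from the same configuration one is a prefix of the
  other.\<close>

lemma mstep_confluent:
  assumes "(mstep prog)\<^sup>*\<^sup>* c d" "(mstep prog)\<^sup>*\<^sup>* c d'"
  shows "(mstep prog)\<^sup>*\<^sup>* d d' \<or> (mstep prog)\<^sup>*\<^sup>* d' d"
  using assms
proof (induction rule: converse_rtranclp_induct)
  case (step c c')
  from step.prems show ?case
  proof (cases rule: converse_rtranclpE)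
    case base
    with step.hyps show ?thesis by (meson converse_rtranclp_into_rtranclp)
  next
    case (step c'')
    with mstep_unique[OF step(1) \<open>mstep prog c c'\<close>] step.IH show ?thesis by blast
  qed
qed blast

lemma within_effect: "within k s \<Longrightarrow> instr_reg i < k \<Longrightarrow> within k (snd (effect i s))"
  by (cases i) (auto simp: within_def)

lemma prog_reg: "(l, i) \<in> set prog \<Longrightarrow> instr_reg i < k"
  using regs by (force simp: prog_regs_def)

lemma within_mstep: "mstep prog c d \<Longrightarrow> within k (snd c) \<Longrightarrow> within k (snd d)"
  using prog_reg within_effect by (auto simp: mstep_def)

definition inv :: "config \<Rightarrow> bool" where
  "inv c \<longleftrightarrow> (case c of (q, nf, nb, s, g) \<Rightarrow> ctl_reg q \<subseteq> {..<k} \<and> within k s)"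

lemma inv_astep: "astep prog h st c c' \<Longrightarrow> inv c \<Longrightarrow> inv c'"
  by (erule astep.cases) (auto simp: inv_def within_def prog_reg)

text \<open>The initial contents are arbitrary since a restart keeps the registers; thus every
  restart lands in a reachable state.\<close>

definition reachable :: "nat \<Rightarrow> (nat \<Rightarrow> nat) \<Rightarrow> bool" where
  "reachable l s \<longleftrightarrow> (\<exists>s0. within k s0 \<and> (mstep prog)\<^sup>*\<^sup>* (st, s0) (l, s))"

lemma reachable_effect:
  "reachable l s \<Longrightarrow> (l, i) \<in> set prog \<Longrightarrow> reachable (fst (effect i s)) (snd (effect i s))"
proof -
  assume "reachable l s" "(l, i) \<in> set prog"
  then obtain s0 where "within k s0" "(mstep prog)\<^sup>*\<^sup>* (st, s0) (l, s)"
    by (auto simp: reachable_def)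
  moreover have "mstep prog (l, s) (effect i s)"
    using \<open>(l, i) \<in> set prog\<close> by (auto simp: mstep_def)
  ultimately show ?thesis
    unfolding reachable_def by (metis prod.collapse rtranclp.rtrancl_into_rtrancl)
qed

text \<open>
  All zero tests since the last restart were correct, and the current instruction will be
  executed correctly unless a token is lost.
\<close>

fun faithful :: "ctl \<Rightarrow> (nat \<Rightarrow> nat) \<Rightarrow> bool" where
  "faithful (Tok l) s \<longleftrightarrow> reachable l s"
| "faithful (Want i) s \<longleftrightarrow> reachable (fst (effect i s)) (snd (effect i s))"
| "faithful (Do i) s \<longleftrightarrow> reachable (fst (effect i s)) (snd (effect i s))"
| "faithful (DecW r l) s \<longleftrightarrow> (s r > 0 \<longrightarrow> reachable l (s(r := s r - 1)))"
| "faithful (DecA r l) s \<longleftrightarrow> reachable l s"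
| "faithful (ZeroW r l) s \<longleftrightarrow> (s r = 0 \<longrightarrow> reachable l s)"
| "faithful Back s \<longleftrightarrow> False"

fun halted :: "ctl \<Rightarrow> bool" where
  "halted (Tok l) \<longleftrightarrow> l = h"
| "halted Back \<longleftrightarrow> True"
| "halted _ \<longleftrightarrow> False"

text \<open>Resources stored in the control: the burnt fuel that has not yet become a unit or ash
  and, in \<open>DecA\<close>, also the consumed unit.\<close>

fun held :: "ctl \<Rightarrow> nat" where
  "held (Do i) = 1"
| "held (DecW r l) = 1"
| "held (DecA r l) = 2"
| "held (ZeroW r l) = 1"
| "held _ = 0"

text \<open>Decreases during one pass through an instruction or one recycling. Its maximum 5
  explains the factor 6 in \<open>measures\<close>.\<close>

fun rank :: "ctl \<Rightarrow> nat" where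
  "rank (Tok l) = 5"
| "rank (Want i) = 4"
| "rank Back = 4"
| "rank (Do i) = 3"
| "rank (DecW r l) = 2"
| "rank (DecA r l) = 1"
| "rank (ZeroW r l) = 1"

definition phase :: "ctl \<Rightarrow> (nat \<Rightarrow> nat) \<Rightarrow> nat" where
  "phase q s = (if halted q then 1 else if faithful q s then 0 else 2)"

fun total :: "config \<Rightarrow> nat" where
  "total (q, nf, nb, s, g) = nf + nb + (\<Sum>r<k. s r) + held q"

text \<open>
  The number of tokens never grows. When no token is lost, an unfaithful simulation can only be
  followed by the halting phase, and that one only by faithful simulations; the second component
  orders these phases. Within a phase the fuel or the ash is used up.
\<close>

fun measures :: "config \<Rightarrow> nat \<times> nat \<times> nat" where
  "measures (q, nf, nb, s, g) = (total (q, nf, nb, s, g), phase q s,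
    6 * (if halted q then nb else nf + (if held q = 0 then 0 else 1)) + rank q)"

lemma sum_upd: "r < k \<Longrightarrow> (\<Sum>x<k. (s(r := n)) x) + s r = (\<Sum>x<k. s x) + (n::nat)"
proof -
  assume "r < k"
  then have "(\<Sum>x<k. s' x) = s' r + (\<Sum>x\<in>{..<k} - {r}. s' x)" for s' :: "nat \<Rightarrow> nat"
    by (simp add: sum.remove)
  from this[of s] this[of "s(r := n)"] show ?thesis by simp
qed

text \<open>By \<open>never\<close>, a faithful token is not at \<open>h\<close>, so phase 0 can be
  left only together with a loss. Wrong guesses count as faithful by the vacuous clauses of
  \<open>faithful\<close>: a wrong decrement has no successor, and a wrong zero test lowers
  \<open>total\<close> when it is carried out.\<close>

lemma measures_decrease:
  assumes never: "\<forall>l s. reachable l s \<longrightarrow> l \<noteq> h"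
    and "astep prog h st c c'" "inv c"
  shows "(measures c', measures c) \<in> less_than <*lex*> less_than <*lex*> less_than"
  using assms(2)
proof cases
  case (fetch l i nf nb s g)
  then have "l \<noteq> h" using h by force
  then show ?thesis using reachable_effect fetch by (auto simp: phase_def)
next
  case (restart nf nb s g)
  then have "reachable st s" using assms(3) by (auto simp: reachable_def inv_def)
  with never show ?thesis using restart by (auto simp: phase_def)
next
  case (inc r l nf nb s g)
  then have "r < k" using assms(3) by (simp add: inv_def)
  from sum_upd[OF this, of s "Suc (s r)"]
  show ?thesis using inc never by (auto simp: phase_def)
next
  case (dec r l l' nf nb s g)
  then show ?thesis by (auto simp: phase_def)
next
  case (jz r l l' nf nb s g)
  then show ?thesis by (auto simp: phase_def)
next
  case (unit s r l nf nb g)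
  then have "r < k" using assms(3) by (simp add: inv_def)
  from sum_upd[OF this, of s "s r - 1"]
  show ?thesis using unit by (auto simp: phase_def)
next
  case (ack r l nf nb s g)
  then show ?thesis using never by (auto simp: phase_def)
next
  case (reset r l nf nb s g)
  then have "r < k" using assms(3) by (simp add: inv_def)
  from sum_upd[OF this, of s 0] have *: "(\<Sum>x<k. (s(r := 0)) x) + s r = (\<Sum>x<k. s x)" by simp
  show ?thesis
  proof (cases "s r = 0")
    case True
    then have "s(r := 0) = s" by auto
    then show ?thesis using True reset never by (auto simp: phase_def)
  next
    \<comment> \<open>At least one unit is buried: the first component drops, whatever happens to
      the phase.\<close>
    case False
    then show ?thesis using reset * by simp
  qed
qed (auto simp: phase_def)

lemma no_infinite_run:
  assumes never: "\<forall>l s. reachable l s \<longrightarrow> l \<noteq> h"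
    and "inv (\<sigma> 0)" "\<And>i. astep prog h st (\<sigma> i) (\<sigma> (Suc i))"
  shows False
proof -
  have "inv (\<sigma> i)" for i
    by (induction i) (simp_all add: assms(2) inv_astep[OF assms(3)])
  then have "(measures (\<sigma> (Suc i)), measures (\<sigma> i)) \<in> less_than <*lex*> less_than <*lex*> less_than" for i
    using measures_decrease[OF never] assms(3) by blast
  moreover have "wf (less_than <*lex*> less_than <*lex*> less_than)" by auto
  ultimately show False
    using wf_no_infinite_down_chainE[of _ "\<lambda>i. measures (\<sigma> i)"] by metis
qed

text \<open>The burnt fuel reappears as a unit or as ash, so ash and units together grow by exactly
  one per instruction.\<close>

lemma mstep_astep:
  assumes "mstep prog (l, s) (l', s')" "within k s"
  obtains nb' g' where "(astep prog h st)\<^sup>*\<^sup>* (Tok l, Suc nf, nb, s, g) (Tok l', nf, nb', s', g')"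
    "nb' + (\<Sum>r<k. s' r) = Suc (nb + (\<Sum>r<k. s r))"
proof -
  from assms(1) obtain i where i: "(l, i) \<in> set prog" "effect i s = (l', s')"
    by (auto simp: mstep_def)
  have start: "(astep prog h st)\<^sup>*\<^sup>* (Tok l, Suc nf, nb, s, g) (Do i, nf, nb, s, g)"
    using astep.fetch[OF i(1)] astep.burn by (meson converse_rtranclp_into_rtranclp r_into_rtranclp)
  have r: "instr_reg i < k" using i(1) by (rule prog_reg)
  show thesis
  proof (cases i)
    case (Inc r m)
    then have "s' = s(r := Suc (s r))" "m = l'" using i(2) by simp_all
    then have "astep prog h st (Do i, nf, nb, s, g) (Tok l', nf, nb, s', g)"
      unfolding Inc by (simp add: astep.inc)
    with start have "(astep prog h st)\<^sup>*\<^sup>* (Tok l, Suc nf, nb, s, g) (Tok l', nf, nb, s', g)"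
      by (rule rtranclp.rtrancl_into_rtrancl)
    moreover have "nb + (\<Sum>r<k. s' r) = Suc (nb + (\<Sum>r<k. s r))"
      using sum_upd[of r s "Suc (s r)"] r Inc \<open>s' = _\<close> by simp
    ultimately show thesis using that by blast
  next
    case (DecJz r m m')
    show thesis
    proof (cases "s r > 0")
      case True
      then have s': "s' = s(r := s r - 1)" "m = l'" using i(2) DecJz by simp_all
      note start
      also have "astep prog h st (Do i, nf, nb, s, g) (DecW r l', nf, nb, s, g)"
        unfolding DecJz s'(2) by (rule astep.dec)
      also have "astep prog h st (DecW r l', nf, nb, s, g) (DecA r l', nf, nb, s', g)"
        unfolding s'(1) using True by (rule astep.unit)
      also have "astep prog h st (DecA r l', nf, nb, s', g) (Tok l', nf, Suc (Suc nb), s', g)"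
        by (rule astep.ack)
      finally (rtranclp.rtrancl_into_rtrancl) have
        "(astep prog h st)\<^sup>*\<^sup>* (Tok l, Suc nf, nb, s, g) (Tok l', nf, Suc (Suc nb), s', g)" .
      moreover have "Suc (Suc nb) + (\<Sum>r<k. s' r) = Suc (nb + (\<Sum>r<k. s r))"
        using sum_upd[of r s "s r - 1"] r DecJz s' True by simp
      ultimately show thesis using that by blast
    next
      case False
      then have s': "s' = s(r := 0)" "s' = s" "m' = l'" using i(2) DecJz by auto
      note start
      also have "astep prog h st (Do i, nf, nb, s, g) (ZeroW r l', nf, nb, s, g)"
        unfolding DecJz s'(3) by (rule astep.jz)
      also have "astep prog h st (ZeroW r l', nf, nb, s, g) (Tok l', nf, Suc nb, s', g(r := s r # g r))"
        unfolding s'(1) by (rule astep.reset)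
      finally (rtranclp.rtrancl_into_rtrancl) have
        "(astep prog h st)\<^sup>*\<^sup>* (Tok l, Suc nf, nb, s, g) (Tok l', nf, Suc nb, s', g(r := s r # g r))" .
      moreover have "Suc nb + (\<Sum>r<k. s' r) = Suc (nb + (\<Sum>r<k. s r))" using s'(2) by simp
      ultimately show thesis using that by blast
    qed
  qed
qed

lemma run_astep:
  assumes "(mstep prog ^^ t) (l, s) (l', s')" "within k s"
  shows "\<exists>nb' g'. (astep prog h st)\<^sup>*\<^sup>* (Tok l, nf + t, nb, s, g) (Tok l', nf, nb', s', g') \<and>
    nb' + (\<Sum>r<k. s' r) = t + nb + (\<Sum>r<k. s r)"
  using assms
proof (induction t arbitrary: l s nb g)
  case 0
  then show ?case by auto
next
  case (Suc t)
  then obtain l1 s1 where 1: "mstep prog (l, s) (l1, s1)" "(mstep prog ^^ t) (l1, s1) (l', s')"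
    by (metis prod.collapse relpowp_Suc_D2)
  from mstep_astep[OF 1(1) Suc.prems(2), of "nf + t" nb g] obtain nb1 g1 where
    2: "(astep prog h st)\<^sup>*\<^sup>* (Tok l, Suc (nf + t), nb, s, g) (Tok l1, nf + t, nb1, s1, g1)"
      "nb1 + (\<Sum>r<k. s1 r) = Suc (nb + (\<Sum>r<k. s r))" .
  have "within k s1" using within_mstep[OF 1(1)] Suc.prems(2) by simp
  from Suc.IH[OF 1(2) this, of nb1 g1] 2 show ?case
    by (metis (no_types, lifting) add.assoc add_Suc add_Suc_right rtranclp_trans)
qed

lemma recycle_all: "(astep prog h st)\<^sup>*\<^sup>* (Tok h, nf, nb, s, g) (Tok h, nf + nb, 0, s, g)"
proof (induction nb arbitrary: nf)
  case (Suc nb)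
  have "(astep prog h st)\<^sup>*\<^sup>* (Tok h, nf, Suc nb, s, g) (Tok h, Suc nf, nb, s, g)"
    using astep.recycle astep.refuel by (meson converse_rtranclp_into_rtranclp r_into_rtranclp)
  also have "(astep prog h st)\<^sup>*\<^sup>* \<dots> (Tok h, Suc nf + nb, 0, s, g)" by (rule Suc.IH)
  finally show ?case by simp
qed simp

text \<open>A round from the contents \<open>sh\<close> left by the previous round takes a fixed
  number of instructions and ends in \<open>sh\<close> again. The units being the same as before,
  conservation puts all the burnt fuel into ash, and recycling pays for the next round.\<close>

lemma infinite_run:
  assumes halts: "\<And>s0. within k s0 \<Longrightarrow> (mstep prog)\<^sup>*\<^sup>* (st, s0) (h, sh)" and "within k s0"
  obtains nf \<sigma> where "\<sigma> 0 = (Tok st, nf, 0, s0, g)" "\<And>i. astep prog h st (\<sigma> i) (\<sigma> (Suc i))"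
proof -
  have wsh: "within k sh"
  proof -
    from halts[OF assms(2)] have "within k (snd (h, sh))"
      by (induction rule: rtranclp_induct) (use assms(2) within_mstep in auto)
    then show ?thesis by simp
  qed
  from halts[OF assms(2)] obtain t0 where t0: "(mstep prog ^^ t0) (st, s0) (h, sh)"
    by (metis rtranclp_imp_relpowp)
  from halts[OF wsh] obtain t where t: "(mstep prog ^^ t) (st, sh) (h, sh)"
    by (metis rtranclp_imp_relpowp)
  define X :: "config set" where "X = {(Tok h, nf, nb, sh, g) | nf nb g. nf + nb \<ge> t}"
  have X: "\<exists>y\<in>X. (astep prog h st)\<^sup>+\<^sup>+ x y" if "x \<in> X" for x
  proof -
    from that obtain nf nb g where x: "x = (Tok h, nf, nb, sh, g)" "nf + nb \<ge> t"
      by (auto simp: X_def)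
    obtain m where m: "nf + nb = m + t" using x(2) by (metis le_Suc_ex add.commute)
    have "(astep prog h st)\<^sup>*\<^sup>* x (Tok h, nf + nb, 0, sh, g)" unfolding x by (rule recycle_all)
    also have "astep prog h st (Tok h, nf + nb, 0, sh, g) (Tok st, m + t, 0, sh, g)"
      unfolding m by (rule astep.restart)
    finally (rtranclp_into_tranclp1) have 1: "(astep prog h st)\<^sup>+\<^sup>+ x (Tok st, m + t, 0, sh, g)" .
    from run_astep[OF t wsh, of m 0 g] obtain nb' g' where
      2: "(astep prog h st)\<^sup>*\<^sup>* (Tok st, m + t, 0, sh, g) (Tok h, m, nb', sh, g')" "nb' = t"
      by auto
    have "(Tok h, m, nb', sh, g') \<in> X" using 2 by (auto simp: X_def)
    with 1 2(1) show ?thesis by (meson tranclp_rtranclp_tranclp)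
  qed
  \<comment> \<open>The first round starts from \<open>s0\<close> and has its own cost
    \<open>t0\<close>; the other \<open>t\<close> units of fuel are kept for the repeated
    rounds.\<close>
  obtain nb' g' where
    run: "(astep prog h st)\<^sup>*\<^sup>* (Tok st, t + t0, 0, s0, g) (Tok h, t, nb', sh, g')"
    using run_astep[OF t0 assms(2), of t 0 g] by blast
  have "(Tok h, t, nb', sh, g') \<in> X" by (auto simp: X_def)
  from chain_exists[OF run this X] obtain \<sigma> where "\<sigma> 0 = (Tok st, t + t0, 0, s0, g)"
    "\<And>i. astep prog h st (\<sigma> i) (\<sigma> (Suc i))" by blast
  with that show thesis by blast
qed

section \<open>Transfer to processes and their barbs\<close>

definition implements :: "proc \<Rightarrow> config \<Rightarrow> bool" where
  "implements P c \<longleftrightarrow> flat P = soup prog h st k c \<and> star_free P \<and> inv c"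

lemma reduces_astep:
  assumes "implements P c" "reduces P P'"
  shows "\<exists>c'. astep prog h st c c' \<and> implements P' c'"
proof -
  from assms have "soup_tau (soup prog h st k c) (flat P')" "star_free P'"
    using reduces_flat unfolding implements_def by metis+
  with soup_tau_astep assms(1) inv_astep show ?thesis unfolding implements_def by metis
qed

lemma astep_reduces:
  assumes "implements P c" "astep prog h st c c'"
  shows "\<exists>P'. reduces P P' \<and> implements P' c'"
proof -
  have "ctl_reg (fst c) \<subseteq> {..<k}" using assms(1) by (cases c) (simp add: implements_def inv_def)
  from astep_soup_tau[OF assms(2) this] have "soup_tau (flat P) (soup prog h st k c')"
    using assms(1) by (simp add: implements_def)
  with assms(1) obtain P' where "reduces P P'" "flat P' = soup prog h st k c'" "star_free P'"
    unfolding implements_def by (metis soup_tau_reduces)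
  with assms inv_astep show ?thesis unfolding implements_def by metis
qed

lemma implements_barb:
  assumes "implements P c" "l \<in> fst ` set prog"
  shows "barb P (In (l + 2))"
proof -
  obtain q nf nb s g where c: "c = (q, nf, nb, s, g)" by (cases c)
  from assms(2) obtain i where "(l, i) \<in> set prog" by auto
  from server_actI(1)[OF this] obtain j K I where
    j: "server prog h st = add_mset j K" "item_act j (Act (In (l + 2))) I" by blast
  then have "\<exists>K'. flat P = add_mset j K'"
    using assms(1) by (auto simp: implements_def c add_mset_commute)
  with j(2) Pre_step show ?thesis unfolding barb_def by metis
qed

lemma implements_omega_barb:
  assumes "implements P (Tok st, nf, 0, s0, g)" "l \<in> fst ` set prog"
    "\<sigma> 0 = (Tok st, nf, 0, s0, g)" "\<And>i. astep prog h st (\<sigma> i) (\<sigma> (Suc i))"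
  shows "omega_barb P (In (l + 2))"
proof -
  obtain Q where Q: "\<And>i. implements (Q i) (\<sigma> i) \<and> (i = 0 \<longrightarrow> Q i = P)"
    "\<And>i. reduces (Q i) (Q (Suc i))"
    using dependent_nat_choice[of "\<lambda>i P'. implements P' (\<sigma> i) \<and> (i = 0 \<longrightarrow> P' = P)"
      "\<lambda>i P' P''. reduces P' P''"] assms astep_reduces
    by (metis nat.distinct(1))
  have "barb (Q i) (In (l + 2))" for i
    using implements_barb[OF _ assms(2)] Q(1) by blast
  moreover have "Q 0 = P" using Q(1) by simp
  ultimately show ?thesis unfolding omega_barb_def using Q(2) by (intro exI[of _ Q]) simp
qed

text \<open>No infinite reduction sequence exists at all, hence the choice of the barb is
  irrelevant.\<close>

lemma implements_no_omega_barb: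
  assumes never: "\<forall>l s. reachable l s \<longrightarrow> l \<noteq> h" and "implements P c"
  shows "\<not> omega_barb P e"
proof
  assume "omega_barb P e"
  then obtain Q where Q: "reduces\<^sup>*\<^sup>* P (Q 0)" "\<And>i. reduces (Q i) (Q (Suc i))"
    unfolding omega_barb_def by blast
  from Q(1) assms(2) have "\<exists>c. implements (Q 0) c"
    by (induction rule: rtranclp_induct) (use reduces_astep in blast)+
  then obtain \<sigma> where \<sigma>: "\<And>i. implements (Q i) (\<sigma> i)" "\<And>i. astep prog h st (\<sigma> i) (\<sigma> (Suc i))"
    using dependent_nat_choice[of "\<lambda>i c. implements (Q i) c" "\<lambda>i c c'. astep prog h st c c'"]
      reduces_astep Q(2) by metis
  have "inv (\<sigma> 0)" using \<sigma>(1) by (simp add: implements_def)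
  from no_infinite_run[OF never this \<sigma>(2)] show False .
qed

end

section \<open>Compilation of recursive functions\<close>

text \<open>The loop decrements its register whenever the body is entered, so that its head is a
  single \<open>DecJz\<close>.\<close>

datatype cmd = CInc nat | CClr nat | CSeq cmd cmd | CWhile nat cmd

inductive exec :: "cmd \<Rightarrow> (nat \<Rightarrow> nat) \<Rightarrow> (nat \<Rightarrow> nat) \<Rightarrow> bool" where
  inc: "exec (CInc r) s (s(r := Suc (s r)))"
| clr: "exec (CClr r) s (s(r := 0))"
| seq: "exec c s s1 \<Longrightarrow> exec d s1 s2 \<Longrightarrow> exec (CSeq c d) s s2"
| stop: "s r = 0 \<Longrightarrow> exec (CWhile r c) s s"
| loop: "s r > 0 \<Longrightarrow> exec c (s(r := s r - 1)) s1 \<Longrightarrow> exec (CWhile r c) s1 s2 \<Longrightarrow>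
    exec (CWhile r c) s s2"

lemma exec_eq: "exec c s s1 \<Longrightarrow> s1 = s2 \<Longrightarrow> exec c s s2"
  by simp

fun len :: "cmd \<Rightarrow> nat" where
  "len (CInc r) = 1"
| "len (CClr r) = 1"
| "len (CSeq c d) = len c + len d"
| "len (CWhile r c) = Suc (len c)"

text \<open>\<open>i\<close> is the first label and \<open>e\<close> the exit label; all labels in between have the parity of \<open>i\<close>.\<close>

fun compile :: "cmd \<Rightarrow> nat \<Rightarrow> nat \<Rightarrow> program" where
  "compile (CInc r) i e = [(i, Inc r e)]"
| "compile (CClr r) i e = [(i, DecJz r i e)]"
| "compile (CSeq c d) i e = compile c i (i + 2 * len c) @ compile d (i + 2 * len c) e"
| "compile (CWhile r c) i e = (i, DecJz r (i + 2) e) # compile c (i + 2) i"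

lemma compile_labels: "map fst (compile c i e) = map (\<lambda>j. i + 2 * j) [0..<len c]"
proof (induction c arbitrary: i e)
  case (CSeq c d)
  have "[0..<len c + len d] = [0..<len c] @ map (\<lambda>j. j + len c) [0..<len d]"
    using upt_add_eq_append[of 0 "len c" "len d"] map_add_upt[of "len c" "len d"]
    by (simp add: add.commute)
  then show ?case using CSeq by (simp add: algebra_simps)
next
  case (CWhile r c)
  have "[0..<Suc (len c)] = 0 # map Suc [0..<len c]"
    unfolding map_Suc_upt by (rule upt_conv_Cons) simp
  then show ?case using CWhile by (simp add: comp_def)
qed simp_all

lemma compile_exec:
  "exec c s s' \<Longrightarrow> set (compile c i e) \<subseteq> set prog \<Longrightarrow> (mstep prog)\<^sup>*\<^sup>* (i, s) (e, s')"
proof (induction arbitrary: i e rule: exec.induct)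
  case (inc r s)
  then have "mstep prog (i, s) (e, s(r := Suc (s r)))" by (force simp: mstep_def)
  then show ?case by blast
next
  case (clr r s)
  show ?case
  proof (induction "s r" arbitrary: s)
    case 0
    then have "s(r := 0) = s" by auto
    moreover have "mstep prog (i, s) (e, s)" using clr 0 by (force simp: mstep_def)
    ultimately show ?case by auto
  next
    case (Suc n)
    then have "mstep prog (i, s) (i, s(r := s r - 1))"
      using clr by (auto simp: mstep_def intro!: exI[of _ "DecJz r i e"])
    moreover have "(mstep prog)\<^sup>*\<^sup>* (i, s(r := s r - 1)) (e, s(r := 0))"
      using Suc(1)[of "s(r := s r - 1)"] Suc(2) by simp
    ultimately show ?case by (rule converse_rtranclp_into_rtranclp)
  qed
next
  case (seq c s s1 d s2)
  from seq.prems seq.IH(1)[of i "i + 2 * len c"] seq.IH(2)[of "i + 2 * len c" e]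
  show ?case by (simp add: rtranclp_trans)
next
  case (stop s r c)
  then have "mstep prog (i, s) (e, s)" by (auto simp: mstep_def intro!: exI[of _ "DecJz r (i + 2) e"])
  then show ?case by blast
next
  case (loop s r c s1 s2)
  then have "mstep prog (i, s) (i + 2, s(r := s r - 1))"
    by (auto simp: mstep_def intro!: exI[of _ "DecJz r (i + 2) e"])
  also have "(mstep prog)\<^sup>*\<^sup>* (i + 2, s(r := s r - 1)) (i, s1)"
    by (rule loop.IH(1)) (use loop.prems in simp)
  also have "(mstep prog)\<^sup>*\<^sup>* (i, s1) (e, s2)" by (rule loop.IH(2)) (rule loop.prems)
  finally show ?case .
qed

section \<open>Register programs for the schemes of recursive functions\<close>

definition move :: "nat \<Rightarrow> nat \<Rightarrow> cmd" where
  "move a b = CWhile a (CInc b)"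

lemma exec_move: "a \<noteq> b \<Longrightarrow> exec (move a b) s (s(a := 0, b := s b + s a))"
proof (induction "s a" arbitrary: s)
  case 0
  then show ?case unfolding move_def by (intro exec_eq[OF exec.stop]) auto
next
  case (Suc n)
  let ?s = "s(a := s a - 1, b := Suc (s b))"
  have "exec (move a b) ?s (?s(a := 0, b := ?s b + ?s a))"
    by (rule Suc(1)) (use Suc in simp_all)
  moreover have "?s(a := 0, b := ?s b + ?s a) = s(a := 0, b := s b + s a)"
    using Suc by auto
  ultimately have rest: "exec (CWhile a (CInc b)) ?s (s(a := 0, b := s b + s a))"
    unfolding move_def by simp
  have first: "exec (CInc b) (s(a := s a - 1)) ?s"
    by (rule exec_eq[OF exec.inc]) (use Suc.prems in auto)
  have "s a > 0" using Suc(2) by simp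
  from exec.loop[OF this first rest] show ?case unfolding move_def .
qed

definition copy :: "nat \<Rightarrow> nat \<Rightarrow> nat \<Rightarrow> cmd" where
  "copy a b t = CSeq (CWhile a (CSeq (CInc t) (CInc b))) (move t a)"

lemma exec_copy:
  assumes "a \<noteq> b" "t \<noteq> a" "t \<noteq> b" "s t = 0"
  shows "exec (copy a b t) s (s(b := s b + s a))"
proof -
  have "exec (CWhile a (CSeq (CInc t) (CInc b))) s (s(a := 0, t := s t + s a, b := s b + s a))" for s
  proof (induction "s a" arbitrary: s)
    case 0
    then show ?case by (intro exec_eq[OF exec.stop]) auto
  next
    case (Suc n)
    let ?s = "s(a := s a - 1, t := Suc (s t), b := Suc (s b))"
    have "exec (CWhile a (CSeq (CInc t) (CInc b))) ?s (?s(a := 0, t := ?s t + ?s a, b := ?s b + ?s a))"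
      by (rule Suc(1)) (use Suc assms in simp_all)
    moreover have "?s(a := 0, t := ?s t + ?s a, b := ?s b + ?s a) =
        s(a := 0, t := s t + s a, b := s b + s a)"
      using Suc assms by auto
    ultimately have rest: "exec (CWhile a (CSeq (CInc t) (CInc b))) ?s
        (s(a := 0, t := s t + s a, b := s b + s a))" by simp
    have first: "exec (CSeq (CInc t) (CInc b)) (s(a := s a - 1)) ?s"
      by (rule exec_eq[OF exec.seq[OF exec.inc exec.inc]]) (use assms in auto)
    have "s a > 0" using Suc(2) by simp
    from exec.loop[OF this first rest] show ?case .
  qed
  note this[of s]
  moreover have "exec (move t a) (s(a := 0, t := s t + s a, b := s b + s a)) (s(b := s b + s a))"
    by (rule exec_eq[OF exec_move]) (use assms in auto)
  ultimately show ?thesis unfolding copy_def by (rule exec.seq)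
qed

fun clear :: "nat \<Rightarrow> nat \<Rightarrow> cmd" where
  "clear a 0 = CClr a"
| "clear a (Suc n) = CSeq (clear a n) (CClr (a + Suc n))"

lemma exec_clear: "exec (clear a n) s (\<lambda>r. if a \<le> r \<and> r \<le> a + n then 0 else s r)"
proof (induction n)
  case 0
  show ?case by (rule exec_eq[of _ _ "s(a := 0)"]) (auto intro: exec.clr)
next
  case (Suc n)
  show ?case unfolding clear.simps
    by (rule exec_eq[OF exec.seq[OF Suc exec.clr]]) auto
qed

lemma clear_regs: "prog_regs (compile (clear a n) i e) \<subseteq> {..a + n}"
proof (induction n arbitrary: i e)
  case (Suc n)
  have "prog_regs (compile (clear a n) i e) \<subseteq> {..a + Suc n}" for i e
    by (rule order.trans[OF Suc]) simp
  then show ?case by (simp add: prog_regs_def image_Un)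
qed (simp add: prog_regs_def)

definition computes :: "cmd \<Rightarrow> nat list \<Rightarrow> nat \<Rightarrow> nat \<Rightarrow> (nat list \<Rightarrow> nat) \<Rightarrow> bool" where
  "computes c args out t f \<longleftrightarrow>
    (\<forall>s. (\<forall>r\<ge>t. s r = 0) \<longrightarrow> exec c s (s(out := s out + f (map s args))))"

definition computable :: "nat \<Rightarrow> (nat list \<Rightarrow> nat) \<Rightarrow> bool" where
  "computable k f \<longleftrightarrow> (\<forall>args out t. length args = k \<longrightarrow> (\<forall>a\<in>set args. a < t) \<longrightarrow> out < t \<longrightarrow>
    out \<notin> set args \<longrightarrow> (\<exists>c. computes c args out t f))"

lemma computableE:
  assumes "computable k f" "length args = k" "\<forall>a\<in>set args. a < t" "out < t" "out \<notin> set args"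
  obtains c where "\<And>s s'. (\<forall>r\<ge>t. s r = 0) \<Longrightarrow> s' = s(out := s out + f (map s args)) \<Longrightarrow> exec c s s'"
proof -
  from assms obtain c where "computes c args out t f" unfolding computable_def by blast
  with that[of c] show thesis unfolding computes_def by simp
qed

lemma computable_list:
  assumes "\<forall>g\<in>set gs. computable k g" "length args = k" "\<forall>a\<in>set args. a < b" "b + length gs \<le> t"
  shows "\<exists>c. \<forall>s. (\<forall>r\<ge>b. s r = 0) \<longrightarrow> exec c s
    (\<lambda>r. if b \<le> r \<and> r < b + length gs then (gs ! (r - b)) (map s args) else s r)"
  using assms
proof (induction gs rule: rev_induct)
  case Nil
  \<comment> \<open>There is no empty command; clearing an empty register takes its place.\<close>
  have "exec (CClr b) s (\<lambda>r. if b \<le> r \<and> r < b + length ([] :: (nat list \<Rightarrow> nat) list)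
      then ([] ! (r - b)) (map s args) else s r)" if "\<forall>r\<ge>b. s r = 0" for s :: "nat \<Rightarrow> nat"
    by (rule exec_eq[OF exec.clr]) (use that in \<open>auto simp: fun_eq_iff\<close>)
  then show ?case by blast
next
  case (snoc g gs)
  then obtain c where c: "\<And>s. (\<forall>r\<ge>b. s r = 0) \<Longrightarrow> exec c s
    (\<lambda>r. if b \<le> r \<and> r < b + length gs then (gs ! (r - b)) (map s args) else s r)" by auto
  have "computable k g" using snoc.prems by simp
  moreover have "b + length gs < t" using snoc.prems(4) by simp
  moreover have "\<forall>a\<in>set args. a < t" using snoc.prems(3) \<open>b + length gs < t\<close> by fastforce
  moreover have "b + length gs \<notin> set args" using snoc.prems(3) by fastforce
  ultimately obtain d where d: "\<And>s s'. (\<forall>r\<ge>t. s r = 0) \<Longrightarrow>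
      s' = s(b + length gs := s (b + length gs) + g (map s args)) \<Longrightarrow> exec d s s'"
    using computableE[of k g args t "b + length gs"] snoc.prems(2) by blast
  have "exec (CSeq c d) s (\<lambda>r. if b \<le> r \<and> r < b + length (gs @ [g])
      then ((gs @ [g]) ! (r - b)) (map s args) else s r)" if s: "\<forall>r\<ge>b. s r = 0" for s
  proof (rule exec.seq[OF c[OF s] d])
    let ?s = "\<lambda>r. if b \<le> r \<and> r < b + length gs then (gs ! (r - b)) (map s args) else s r"
    show "\<forall>r\<ge>t. ?s r = 0" using s snoc.prems(4) by auto
    have "map ?s args = map s args" using snoc.prems(3) by auto
    then show "(\<lambda>r. if b \<le> r \<and> r < b + length (gs @ [g])
      then ((gs @ [g]) ! (r - b)) (map s args) else s r) =
      ?s(b + length gs := ?s (b + length gs) + g (map ?s args))"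
      using s by (simp only:) (auto simp: fun_eq_iff nth_append)
  qed
  then show ?case by blast
qed

lemma computable_comp:
  assumes f: "computable (length gs) f" and gs: "\<forall>g\<in>set gs. computable k g"
  shows "computable k (\<lambda>xs. f (map (\<lambda>g. g xs) gs))"
  unfolding computable_def
proof (intro allI impI)
  fix args :: "nat list" and out t :: nat
  assume args: "length args = k" "\<forall>a\<in>set args. a < t" "out < t" "out \<notin> set args"
  let ?m = "length gs"
  from computable_list[OF gs args(1,2), of "t + ?m"] obtain c where
    c: "\<And>s. (\<forall>r\<ge>t. s r = 0) \<Longrightarrow> exec c s
    (\<lambda>r. if t \<le> r \<and> r < t + ?m then (gs ! (r - t)) (map s args) else s r)" by auto
  from computableE[OF f, of "[t..<t + ?m]" "t + ?m" out] args obtain d where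
    d: "\<And>s s'. (\<forall>r\<ge>t + ?m. s r = 0) \<Longrightarrow> s' = s(out := s out + f (map s [t..<t + ?m])) \<Longrightarrow>
      exec d s s'" by auto
  \<comment> \<open>\<open>clear t ?m\<close> includes the register \<open>t + ?m\<close>, one more
    than the intermediate results occupy; that one is empty anyway.\<close>
  have "exec (CSeq c (CSeq d (clear t ?m))) s
      (s(out := s out + f (map (\<lambda>g. g (map s args)) gs)))" if s: "\<forall>r\<ge>t. s r = 0" for s
  proof -
    let ?s = "\<lambda>r. if t \<le> r \<and> r < t + ?m then (gs ! (r - t)) (map s args) else s r"
    have "map ?s [t..<t + ?m] = map (\<lambda>g. g (map s args)) gs"
      by (rule nth_equalityI) auto
    then have "exec d ?s (?s(out := ?s out + f (map (\<lambda>g. g (map s args)) gs)))"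
      using s by (intro d) auto
    then show ?thesis
      by (rule exec.seq[OF c[OF s] exec.seq[OF _ exec_eq[OF exec_clear]]])
        (use s args(3) in \<open>auto simp: fun_eq_iff\<close>)
  qed
  then show "\<exists>c. computes c args out t (\<lambda>xs. f (map (\<lambda>g. g xs) gs))"
    unfolding computes_def by blast
qed

lemma computable_prim_rec:
  assumes f: "computable k f" and g: "computable (Suc (Suc k)) g"
  shows "computable (Suc k) (\<lambda>xs. rec_nat (f (tl xs)) (\<lambda>n r. g (n # r # tl xs)) (hd xs))"
  unfolding computable_def
proof (intro allI impI)
  fix args :: "nat list" and out t :: nat
  assume args: "length args = Suc k" "\<forall>a\<in>set args. a < t" "out < t" "out \<notin> set args"
  then obtain a as where as: "args = a # as" by (cases args) auto
  let ?R = "t" and ?N = "t + 1" and ?I = "t + 2" and ?V = "t + 3" and ?T = "t + 4"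
  have lt: "a < t" "\<forall>a\<in>set as. a < t" using args as by auto
  have "length as = k" "\<forall>a\<in>set as. a < ?T" "?R < ?T" "?R \<notin> set as"
    using args(1) lt as by auto
  then obtain cf where
    cf: "\<And>s s'. (\<forall>r\<ge>?T. s r = 0) \<Longrightarrow> s' = s(?R := s ?R + f (map s as)) \<Longrightarrow> exec cf s s'"
    using computableE[OF f] by metis
  have "length (?I # ?R # as) = Suc (Suc k)" "\<forall>a\<in>set (?I # ?R # as). a < ?T" "?V < ?T"
    "?V \<notin> set (?I # ?R # as)"
    using args(1) lt as by auto
  then obtain cg where
    "\<And>s s'. (\<forall>r\<ge>?T. s r = 0) \<Longrightarrow> s' = s(?V := s ?V + g (map s (?I # ?R # as))) \<Longrightarrow> exec cg s s'"
    using computableE[OF g] by metis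
  then have cg: "\<And>s s'. (\<forall>r\<ge>?T. s r = 0) \<Longrightarrow> s' = s(?V := s ?V + g (s ?I # s ?R # map s as)) \<Longrightarrow>
      exec cg s s'"
    by simp
  define body where "body = CSeq cg (CSeq (CClr ?R) (CSeq (move ?V ?R) (CInc ?I)))"
  define c where "c = CSeq cf (CSeq (copy a ?N ?T) (CSeq (CWhile ?N body) (CSeq (move ?R out) (CClr ?I))))"
  have "exec c s (s(out := s out + rec_nat (f (map s as)) (\<lambda>n r. g (n # r # map s as)) (s a)))"
    if s: "\<forall>r\<ge>t. s r = 0" for s
  proof -
    define rc where "rc = rec_nat (f (map s as)) (\<lambda>n r. g (n # r # map s as))"
    have rc: "rc 0 = f (map s as)" "rc (Suc i) = g (i # rc i # map s as)" for i
      by (simp_all add: rc_def)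
    have upd: "map (s(?R := x, ?N := y, ?I := z)) as = map s as" for x y z
      using lt by auto
    have body: "exec body (s(?R := rc i, ?N := j, ?I := i))
        (s(?R := rc (Suc i), ?N := j, ?I := Suc i))" for i j
    proof -
      let ?s = "s(?R := rc i, ?N := j, ?I := i)"
      have 1: "exec cg ?s (?s(?V := rc (Suc i)))"
      proof (rule cg)
        show "\<forall>r\<ge>?T. ?s r = 0" using s by auto
        show "?s(?V := rc (Suc i)) = ?s(?V := ?s ?V + g (?s ?I # ?s ?R # map ?s as))"
          unfolding upd using s by (simp add: rc)
      qed
      have 2: "exec (move ?V ?R) (?s(?V := rc (Suc i), ?R := 0)) (?s(?R := rc (Suc i)))"
        by (rule exec_eq[OF exec_move]) (use s in \<open>auto simp: fun_eq_iff\<close>)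
      show ?thesis unfolding body_def
        by (rule exec.seq[OF 1 exec.seq[OF exec.clr exec.seq[OF 2 exec_eq[OF exec.inc]]]])
          (auto simp: fun_eq_iff)
    qed
    have loop: "exec (CWhile ?N body) (s(?R := rc i, ?N := j, ?I := i))
        (s(?R := rc (i + j), ?N := 0, ?I := i + j))" for i j
    proof (induction j arbitrary: i)
      case 0
      show ?case by (rule exec_eq[OF exec.stop]) auto
    next
      case (Suc j)
      let ?s = "s(?R := rc i, ?N := Suc j, ?I := i)"
      have e: "?s(?N := ?s ?N - 1) = s(?R := rc i, ?N := j, ?I := i)"
        by auto
      show ?case
      proof (rule exec.loop)
        show "?s ?N > 0" by simp
        show "exec body (?s(?N := ?s ?N - 1)) (s(?R := rc (Suc i), ?N := j, ?I := Suc i))"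
          unfolding e by (rule body)
        show "exec (CWhile ?N body) (s(?R := rc (Suc i), ?N := j, ?I := Suc i))
            (s(?R := rc (i + Suc j), ?N := 0, ?I := i + Suc j))"
          using Suc[of "Suc i"] by (simp only: add_Suc add_Suc_right)
      qed
    qed
    have 1: "exec cf s (s(?R := rc 0))" by (rule cf) (use s in \<open>auto simp: rc\<close>)
    have 2: "exec (copy a ?N ?T) (s(?R := rc 0)) (s(?R := rc 0, ?N := s a, ?I := 0))"
      by (rule exec_eq[OF exec_copy]) (use s lt in \<open>auto simp: fun_eq_iff\<close>)
    have 3: "exec (move ?R out) (s(?R := rc (0 + s a), ?N := 0, ?I := 0 + s a))
        (s(out := s out + rc (s a), ?I := s a))"
      by (rule exec_eq[OF exec_move]) (use s args(3) in \<open>auto simp: fun_eq_iff\<close>)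
    show ?thesis unfolding c_def rc_def[symmetric]
      by (rule exec.seq[OF 1 exec.seq[OF 2 exec.seq[OF loop exec.seq[OF 3 exec_eq[OF exec.clr]]]]])
        (use s args(3) in \<open>auto simp: fun_eq_iff\<close>)
  qed
  then show "\<exists>c. computes c args out t
      (\<lambda>xs. rec_nat (f (tl xs)) (\<lambda>n r. g (n # r # tl xs)) (hd xs))"
    unfolding computes_def as by auto
qed

lemma computable_minimise:
  assumes f: "computable (Suc k) f" and total: "\<forall>xs. length xs = k \<longrightarrow> (\<exists>n. f (n # xs) = 0)"
  shows "computable k (\<lambda>xs. LEAST n. f (n # xs) = 0)"
  unfolding computable_def
proof (intro allI impI)
  fix args :: "nat list" and out t :: nat
  assume args: "length args = k" "\<forall>a\<in>set args. a < t" "out < t" "out \<notin> set args"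
  let ?I = "t" and ?Y = "t + 1" and ?T = "t + 2"
  have "length (?I # args) = Suc k" "\<forall>a\<in>set (?I # args). a < ?T" "?Y < ?T"
    "?Y \<notin> set (?I # args)"
    using args by auto
  then obtain cf where
    "\<And>s s'. (\<forall>r\<ge>?T. s r = 0) \<Longrightarrow> s' = s(?Y := s ?Y + f (map s (?I # args))) \<Longrightarrow> exec cf s s'"
    using computableE[OF f] by metis
  then have cf: "\<And>s s'. (\<forall>r\<ge>?T. s r = 0) \<Longrightarrow> s' = s(?Y := s ?Y + f (s ?I # map s args)) \<Longrightarrow>
      exec cf s s'"
    by simp
  \<comment> \<open>Entering the loop decrements \<open>?Y\<close> only once, so the rest of the
    rejected value must be cleared before the next evaluation.\<close>
  define body where "body = CSeq (CClr ?Y) (CSeq (CInc ?I) cf)"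
  define c where "c = CSeq cf (CSeq (CWhile ?Y body) (move ?I out))"
  have "exec c s (s(out := s out + (LEAST n. f (n # map s args) = 0)))"
    if s: "\<forall>r\<ge>t. s r = 0" for s
  proof -
    define m where "m = (LEAST n. f (n # map s args) = 0)"
    have "\<exists>n. f (n # map s args) = 0" using total args(1) by simp
    then have m: "f (m # map s args) = 0" unfolding m_def by (rule LeastI_ex)
    have min: "m \<le> n" if "f (n # map s args) = 0" for n
      unfolding m_def using that by (rule Least_le)
    have upd: "map (s(?I := x, ?Y := y)) args = map s args" for x y
      using args(2) by auto
    have ev: "exec cf (s(?I := i, ?Y := 0)) (s(?I := i, ?Y := f (i # map s args)))" for i
    proof (rule cf)
      show "\<forall>r\<ge>?T. (s(?I := i, ?Y := 0)) r = 0" using s by auto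
      show "s(?I := i, ?Y := f (i # map s args)) = (s(?I := i, ?Y := 0))(?Y :=
          (s(?I := i, ?Y := 0)) ?Y + f ((s(?I := i, ?Y := 0)) ?I # map (s(?I := i, ?Y := 0)) args))"
        unfolding upd by simp
    qed
    have body: "exec body (s(?I := i, ?Y := y)) (s(?I := Suc i, ?Y := f (Suc i # map s args)))" for i y
    proof -
      have 1: "exec (CClr ?Y) (s(?I := i, ?Y := y)) (s(?I := i, ?Y := 0))"
        by (rule exec_eq[OF exec.clr]) auto
      have 2: "exec (CInc ?I) (s(?I := i, ?Y := 0)) (s(?I := Suc i, ?Y := 0))"
        by (rule exec_eq[OF exec.inc]) (auto simp: fun_eq_iff)
      show ?thesis unfolding body_def by (rule exec.seq[OF 1 exec.seq[OF 2 ev]])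
    qed
    have loop: "exec (CWhile ?Y body) (s(?I := i, ?Y := f (i # map s args))) (s(?I := m, ?Y := 0))"
      if "i + j = m" for i j
      using that
    proof (induction j arbitrary: i)
      case 0
      then show ?case using m by (intro exec_eq[OF exec.stop]) auto
    next
      case (Suc j)
      let ?y = "f (i # map s args)"
      let ?s = "s(?I := i, ?Y := ?y)"
      have e: "?s(?Y := ?s ?Y - 1) = s(?I := i, ?Y := ?s ?Y - 1)"
        by auto
      show ?case
      proof (rule exec.loop)
        show "?s ?Y > 0" using min[of i] Suc.prems by auto
        show "exec body (?s(?Y := ?s ?Y - 1)) (s(?I := Suc i, ?Y := f (Suc i # map s args)))"
          unfolding e by (rule body)
        show "exec (CWhile ?Y body) (s(?I := Suc i, ?Y := f (Suc i # map s args)))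
            (s(?I := m, ?Y := 0))"
          by (rule Suc.IH) (use Suc.prems in simp)
      qed
    qed
    have "s = s(?I := 0, ?Y := 0)" using s by auto
    with ev[of 0] have 1: "exec cf s (s(?I := 0, ?Y := f (0 # map s args)))" by simp
    show ?thesis unfolding c_def m_def[symmetric]
      by (rule exec.seq[OF 1 exec.seq[OF loop[of 0 m] exec_eq[OF exec_move]]])
        (use s args(3) in \<open>auto simp: fun_eq_iff\<close>)
  qed
  then show "\<exists>c. computes c args out t (\<lambda>xs. LEAST n. f (n # xs) = 0)"
    unfolding computes_def by blast
qed

lemma recursive_computable: "recursive k f \<Longrightarrow> computable k f"
proof (induction rule: recursive.induct)
  case (zero k)
  have "exec (CClr t) s s" if "\<forall>r\<ge>t. s r = 0" for s :: "nat \<Rightarrow> nat" and t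
    by (rule exec_eq[OF exec.clr]) (use that in auto)
  then have "computes (CClr t) args out t (\<lambda>xs. 0)" for args out t
    unfolding computes_def by simp
  then show ?case unfolding computable_def by blast
next
  case succ
  show ?case unfolding computable_def
  proof (intro allI impI)
    fix args :: "nat list" and out t :: nat
    assume args: "length args = 1" "\<forall>a\<in>set args. a < t" "out < t" "out \<notin> set args"
    then obtain a where a: "args = [a]" by (cases args) auto
    have "exec (CSeq (copy a out t) (CInc out)) s (s(out := s out + Suc (s a)))"
      if "\<forall>r\<ge>t. s r = 0" for s
      by (rule exec.seq[OF exec_copy exec_eq[OF exec.inc]]) (use args a that in auto)
    then show "\<exists>c. computes c args out t (\<lambda>xs. Suc (xs ! 0))"
      unfolding computes_def a by auto
  qed
next
  case (proj i k)
  show ?case unfolding computable_def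
  proof (intro allI impI)
    fix args :: "nat list" and out t :: nat
    assume args: "length args = k" "\<forall>a\<in>set args. a < t" "out < t" "out \<notin> set args"
    have "args ! i \<in> set args" using proj args(1) by simp
    with args(2-4) have "args ! i \<noteq> out" "args ! i < t" by auto
    then have "exec (copy (args ! i) out t) s (s(out := s out + map s args ! i))"
      if "\<forall>r\<ge>t. s r = 0" for s
      by (intro exec_eq[OF exec_copy]) (use args(1,3) proj that in auto)
    then show "\<exists>c. computes c args out t (\<lambda>xs. xs ! i)"
      unfolding computes_def by blast
  qed
next
  case (comp gs f k)
  then show ?case using computable_comp by simp
next
  case (prim_rec k f g)
  then show ?case using computable_prim_rec by simp
next
  case (minimise k f)
  then show ?case using computable_minimise by simp
qed

section \<open>The code of an instance is recursive in the code of its main process\<close>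

text \<open>
  The values of a recursive function on lists of the wrong length are determined by the way it is
  built; the predicate below disregards them.
\<close>

definition recfun :: "nat \<Rightarrow> (nat list \<Rightarrow> nat) \<Rightarrow> bool" where
  "recfun k F \<longleftrightarrow> (\<exists>f. recursive k f \<and> (\<forall>xs. length xs = k \<longrightarrow> f xs = F xs))"

lemma recfun_comp1:
  assumes "recfun 1 G" "recfun k F"
  shows "recfun k (\<lambda>xs. G [F xs])"
proof -
  from assms obtain g f where g: "recursive 1 g" "\<And>xs. length xs = 1 \<Longrightarrow> g xs = G xs"
    and f: "recursive k f" "\<And>xs. length xs = k \<Longrightarrow> f xs = F xs"
    unfolding recfun_def by metis
  have "recursive k (\<lambda>xs. g (map (\<lambda>f. f xs) [f]))"
    using g f by (intro recursive.comp) simp_all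
  moreover have "g (map (\<lambda>f. f xs) [f]) = G [F xs]" if "length xs = k" for xs
    using g f that by simp
  ultimately show ?thesis unfolding recfun_def by blast
qed

lemma recfun_comp2:
  assumes "recfun 2 G" "recfun k F" "recfun k F'"
  shows "recfun k (\<lambda>xs. G [F xs, F' xs])"
proof -
  from assms obtain g f f' where g: "recursive 2 g" "\<And>xs. length xs = 2 \<Longrightarrow> g xs = G xs"
    and f: "recursive k f" "\<And>xs. length xs = k \<Longrightarrow> f xs = F xs"
    and f': "recursive k f'" "\<And>xs. length xs = k \<Longrightarrow> f' xs = F' xs"
    unfolding recfun_def by metis
  have "recursive k (\<lambda>xs. g (map (\<lambda>f. f xs) [f, f']))"
    using g f f' by (intro recursive.comp) (simp_all add: numeral_2_eq_2)
  moreover have "g (map (\<lambda>f. f xs) [f, f']) = G [F xs, F' xs]" if "length xs = k" for xs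
    using g f f' that by simp
  ultimately show ?thesis unfolding recfun_def by blast
qed

lemma recfun_rec:
  assumes "recfun k F" "recfun (Suc (Suc k)) G"
  shows "recfun (Suc k) (\<lambda>xs. rec_nat (F (tl xs)) (\<lambda>n r. G (n # r # tl xs)) (hd xs))"
proof -
  from assms obtain f g where f: "recursive k f" "\<And>xs. length xs = k \<Longrightarrow> f xs = F xs"
    and g: "recursive (Suc (Suc k)) g" "\<And>xs. length xs = Suc (Suc k) \<Longrightarrow> g xs = G xs"
    unfolding recfun_def by metis
  have "rec_nat (f (tl xs)) (\<lambda>n r. g (n # r # tl xs)) m =
    rec_nat (F (tl xs)) (\<lambda>n r. G (n # r # tl xs)) m" if "length xs = Suc k" for xs m
    using f g that by (induction m) simp_all
  with recursive.prim_rec[OF f(1) g(1)] show ?thesis unfolding recfun_def by blast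
qed

lemma recfun_proj: "i < k \<Longrightarrow> recfun k (\<lambda>xs. xs ! i)"
  unfolding recfun_def using recursive.proj by blast

lemma recfun_Suc:
  assumes "recfun k F"
  shows "recfun k (\<lambda>xs. Suc (F xs))"
proof -
  have "recfun 1 (\<lambda>xs. Suc (xs ! 0))" unfolding recfun_def using recursive.succ by blast
  from recfun_comp1[OF this assms] show ?thesis by simp
qed

lemma recfun_const: "recfun k (\<lambda>xs. c)"
proof (induction c)
  case 0
  show ?case unfolding recfun_def using recursive.zero by blast
qed (rule recfun_Suc)

lemma recfun_add:
  assumes "recfun k F" "recfun k G"
  shows "recfun k (\<lambda>xs. F xs + G xs)"
proof -
  have rec: "rec_nat a (\<lambda>n r. Suc r) b = b + a" for a b
    by (induction b) simp_all
  have "recfun (Suc 1) (\<lambda>xs. rec_nat (tl xs ! 0) (\<lambda>n r. Suc ((n # r # tl xs) ! 1)) (hd xs))"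
    by (rule recfun_rec[of 1 "\<lambda>xs. xs ! 0" "\<lambda>xs. Suc (xs ! 1)"])
      (auto intro!: recfun_proj recfun_Suc)
  moreover have "Suc 1 = (2 :: nat)" by simp
  ultimately have "recfun 2 (\<lambda>xs. rec_nat (tl xs ! 0) (\<lambda>n r. Suc ((n # r # tl xs) ! 1)) (hd xs))"
    by metis
  from recfun_comp2[OF this assms] show ?thesis by (simp add: rec)
qed

lemma recfun_triangle:
  assumes "recfun k F"
  shows "recfun k (\<lambda>xs. triangle (F xs))"
proof -
  have rec: "rec_nat 0 (\<lambda>n r. r + Suc n) b = triangle b" for b
    by (induction b) simp_all
  have "recfun 1 (\<lambda>xs. rec_nat 0 (\<lambda>n r. (n # r # tl xs) ! 1 + Suc ((n # r # tl xs) ! 0)) (hd xs))"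
    unfolding One_nat_def
    by (rule recfun_rec[of 0 "\<lambda>xs. 0" "\<lambda>xs. xs ! Suc 0 + Suc (xs ! 0)"])
      (auto intro!: recfun_proj recfun_Suc recfun_const recfun_add)
  from recfun_comp1[OF this assms] show ?thesis by (simp add: rec del: add_Suc_right)
qed

lemma recfun_prod_encode:
  assumes "recfun k F" "recfun k G"
  shows "recfun k (\<lambda>xs. prod_encode (F xs, G xs))"
  unfolding prod_encode_def using assms by (simp add: recfun_add recfun_triangle)

lemmas recfun_intros = recfun_prod_encode recfun_Suc recfun_add recfun_const recfun_proj

text \<open>
  The labels of the loader are even and those of the compiled program odd, so that the loader
  depends on \<open>n\<close> alone.
\<close>

definition load :: "nat \<Rightarrow> nat \<times> instr" where
  "load i = (2 * i, Inc 0 (2 * i + 2))"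

text \<open>A jump to label 1, the entry of the compiled function: register 1, its output register,
  is still empty.\<close>

definition load_end :: "nat \<Rightarrow> nat \<times> instr" where
  "load_end n = (2 * n, DecJz 1 (2 * n) 1)"

definition loader :: "nat \<Rightarrow> program" where
  "loader n = load_end n # map load [0..<n]"

text \<open>Each level wraps the previous process into one more \<open>Par\<close>, so the codes
  follow a primitive recursion in \<open>n\<close>.\<close>

fun load_procs :: "nat \<Rightarrow> proc" where
  "load_procs 0 = Nil_proc"
| "load_procs (Suc n) = Par (instr_proc (load n)) (load_procs n)"

definition loader_proc :: "nat \<Rightarrow> proc" where
  "loader_proc n = Par (instr_proc (load_end n)) (load_procs n)"

lemmas proc_defs = instr_proc_def load_def load_end_def burn_def token_def unit_def await_dec_def
  reset_def exec_instr.simps ctr_loc_def lock_loc_def open_loc_def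

lemma recfun_load_procs:
  assumes "recfun k F"
  shows "recfun k (\<lambda>xs. encode_proc (load_procs (F xs)))"
proof -
  \<comment> \<open>Once unfolded, the code consists of pairings of constants and linear terms;
    \<open>mult_2\<close> turns doubling into addition.\<close>
  have load: "recfun 2 (\<lambda>xs. encode_proc (instr_proc (load (xs ! 0))))"
    by (simp add: proc_defs mult_2) (intro recfun_intros; simp)
  have rec: "rec_nat (encode_proc Nil_proc) (\<lambda>n r. prod_encode (1, prod_encode
      (encode_proc (instr_proc (load n)), r))) b = encode_proc (load_procs b)" for b
    by (induction b) simp_all
  have "recfun 1 (\<lambda>xs. rec_nat (encode_proc Nil_proc) (\<lambda>n r. prod_encode (1, prod_encode
      (encode_proc (instr_proc (load ((n # r # tl xs) ! 0))), (n # r # tl xs) ! 1))) (hd xs))"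
    unfolding One_nat_def
    by (rule recfun_rec[of 0 "\<lambda>xs. encode_proc Nil_proc" "\<lambda>xs. prod_encode (1, prod_encode
      (encode_proc (instr_proc (load (xs ! 0))), xs ! 1))", unfolded One_nat_def])
      (use load in \<open>auto intro!: recfun_intros simp: numeral_2_eq_2\<close>)
  from recfun_comp1[OF this assms] show ?thesis unfolding nth_Cons_0 list.sel nth_Cons_Suc One_nat_def
    by (simp only: rec[unfolded One_nat_def])
qed

text \<open>\<open>In 2\<close> is the input on the channel of label 0, for which every loader
  provides a server.\<close>

definition start_instance :: "proc \<Rightarrow> nat \<Rightarrow> adaptation_instance" where
  "start_instance Q n = (Par Q (loader_proc n), [fuel], In 2)"

text \<open>The argument is itself the code of \<open>Q\<close> and is paired in as it is; nothing
  has to be decoded.\<close>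

lemma recfun_start_instance:
  obtains S where "recursive 1 S" "\<And>Q n. n = encode_proc Q \<Longrightarrow> S [n] = encode_instance (start_instance Q n)"
proof -
  have "recfun 1 (\<lambda>xs. encode_proc (instr_proc (load_end (xs ! 0))))"
    by (simp add: proc_defs mult_2) (intro recfun_intros; simp)
  then have "recfun 1 (\<lambda>xs. prod_encode (prod_encode (1, prod_encode (xs ! 0,
      prod_encode (1, prod_encode (encode_proc (instr_proc (load_end (xs ! 0))),
        encode_proc (load_procs (xs ! 0)))))),
      prod_encode (list_encode (map encode_proc [fuel]), encode_act (In 2))))"
    by (intro recfun_intros recfun_load_procs) simp_all
  then obtain S where S: "recursive 1 S" "\<And>xs. length xs = 1 \<Longrightarrow> S xs = prod_encode (prod_encode (1,
      prod_encode (xs ! 0,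
      prod_encode (1, prod_encode (encode_proc (instr_proc (load_end (xs ! 0))),
        encode_proc (load_procs (xs ! 0)))))),
      prod_encode (list_encode (map encode_proc [fuel]), encode_act (In 2)))"
    unfolding recfun_def by metis
  have "S [n] = encode_instance (start_instance Q n)" if "n = encode_proc Q" for Q n
    using S(2)[of "[n]"] that by (simp add: start_instance_def loader_proc_def)
  with S(1) that show thesis by blast
qed

section \<open>The reduction\<close>

definition par_all :: "proc list \<Rightarrow> proc" where
  "par_all Ps = foldr Par Ps Nil_proc"

lemma flat_par_all: "flat (par_all Ps) = (\<Sum>P\<leftarrow>Ps. flat P)"
  by (induction Ps) (simp_all add: par_all_def)

lemma star_free_par_all: "star_free (par_all Ps) \<longleftrightarrow> (\<forall>P\<in>set Ps. star_free P)"
  by (induction Ps) (simp_all add: par_all_def)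

definition machine_proc :: "program \<Rightarrow> nat \<Rightarrow> nat \<Rightarrow> nat \<Rightarrow> proc" where
  "machine_proc prog h st k = par_all (map instr_proc prog @ restart_procs h st @
    tok st # map (\<lambda>r. Loc (ctr_loc r) (Loc (lock_loc r) Nil_proc)) [0..<k])"

lemma flat_instr_proc: "flat (instr_proc i) = {#Thr (instr_proc i)#}"
  by (cases i) (simp add: instr_proc_def)

lemma flat_load_procs: "flat (load_procs n) = image_mset Thr (mset (map instr_proc (map load [0..<n])))"
  by (induction n) (simp_all add: flat_instr_proc del: mset_upt)

lemma sum_list_single: "(\<Sum>x\<leftarrow>xs. {#f x#}) = image_mset f (mset xs)"
  by (induction xs) simp_all

lemma flat_par_power: "flat (par_power m fuel) = replicate_mset m (Thr fuel)"
  by (induction m fuel rule: par_power.induct) (simp_all add: flat_token)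

lemma flat_start: "flat (Par (Par (machine_proc prog h st k) (loader_proc n)) (par_power m fuel)) =
    soup (prog @ loader n) h st k (Tok st, m, 0, \<lambda>_. 0, \<lambda>_. [])"
proof -
  have "flat (machine_proc prog h st k) = image_mset Thr (mset (map instr_proc prog)) +
      image_mset Thr (mset (restart_procs h st)) + {#Thr (tok st)#} +
      regs {..<k} Back (\<lambda>_. 0) (\<lambda>_. [])"
    by (simp add: machine_proc_def flat_par_all flat_instr_proc sum_list_single restart_procs_def
      flat_token comp_def regs_def reg_def reg_content_def atLeast0LessThan multiset.map_comp)
  then show ?thesis
    by (simp add: loader_proc_def flat_load_procs flat_instr_proc flat_par_power server_def
      loader_def add.assoc multiset.map_comp del: mset_upt)
qed

lemma star_free_instr_proc: "star_free (instr_proc i)"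
proof -
  obtain l ins where "i = (l, ins)" by (cases i)
  then show ?thesis by (cases ins) (simp_all add: proc_defs)
qed

lemma star_free_start: "star_free (machine_proc prog h st k)" "star_free (loader_proc n)"
  "star_free (par_power m fuel)"
proof -
  show "star_free (machine_proc prog h st k)"
    by (auto simp: machine_proc_def star_free_par_all star_free_instr_proc restart_procs_def
      recycle_def token_def)
  have "star_free (load_procs n)" by (induction n) (simp_all add: star_free_instr_proc)
  then show "star_free (loader_proc n)" by (simp add: loader_proc_def star_free_instr_proc)
  show "star_free (par_power m fuel)"
    by (induction m fuel rule: par_power.induct) (simp_all add: token_def)
qed

lemma cluster_single: "cluster [M] P = {Par P (par_power m M) | m. True}"
  by (force simp: cluster_def length_Suc_conv)

locale start_machine = machine "prog @ loader n" h st k for prog n h st k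
begin

lemma implements_start:
  "implements (Par (Par (machine_proc prog h st k) (loader_proc n)) (par_power m fuel))
    (Tok st, m, 0, \<lambda>_. 0, \<lambda>_. [])"
  unfolding implements_def using flat_start star_free_start
  by (simp add: inv_def within_def)

lemma start_adaptation_halts:
  assumes "\<And>s0. within k s0 \<Longrightarrow> (mstep (prog @ loader n))\<^sup>*\<^sup>* (st, s0) (h, sh)"
  shows "start_instance (machine_proc prog h st k) n \<notin> eventual_adaptation"
proof -
  have "within k (\<lambda>_. 0)" by (simp add: within_def)
  from infinite_run[OF assms this] obtain nf \<sigma> where "\<sigma> 0 = (Tok st, nf, 0, \<lambda>_. 0, \<lambda>_. [])"
    "\<And>i. astep (prog @ loader n) h st (\<sigma> i) (\<sigma> (Suc i))" by metis
  \<comment> \<open>Label 0 belongs to \<open>load 0\<close> or, for the input 0, to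
    \<open>load_end 0\<close>.\<close>
  moreover have "0 \<in> fst ` set (prog @ loader n)"
  proof (cases n)
    case (Suc m)
    have "load 0 \<in> set (loader n)" by (simp add: loader_def Suc del: upt_Suc)
    then show ?thesis by (force simp: load_def)
  qed (simp add: loader_def load_end_def)
  ultimately have "omega_barb (Par (Par (machine_proc prog h st k) (loader_proc n))
      (par_power nf fuel)) (In (0 + 2))"
    by (intro implements_omega_barb[OF implements_start])
  then show ?thesis
    by (auto simp: eventual_adaptation_def start_instance_def cluster_single numeral_2_eq_2)
qed

lemma start_adaptation_never_halts:
  assumes "\<forall>l s. reachable l s \<longrightarrow> l \<noteq> h"
  shows "start_instance (machine_proc prog h st k) n \<in> eventual_adaptation"
  using implements_no_omega_barb[OF assms implements_start]
  by (auto simp: eventual_adaptation_def start_instance_def cluster_single)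

end

lemma loader_runs:
  assumes "set (loader n) \<subseteq> set prog"
  shows "(mstep prog)\<^sup>*\<^sup>* (0, \<lambda>_. 0) (1, (\<lambda>_. 0)(0 := n))"
proof -
  have "(mstep prog)\<^sup>*\<^sup>* (0, \<lambda>_. 0) (2 * i, (\<lambda>_. 0)(0 := i))" if "i \<le> n" for i
    using that
  proof (induction i)
    case 0
    then show ?case by (simp add: fun_upd_idem)
  next
    case (Suc i)
    have "load i \<in> set prog" using assms Suc.prems by (auto simp: loader_def)
    then have "mstep prog (2 * i, (\<lambda>_. 0)(0 := i)) (2 * Suc i, (\<lambda>_. 0)(0 := Suc i))"
      by (auto simp: mstep_def load_def intro!: exI[of _ "Inc 0 (2 * i + 2)"])
    with Suc show ?case by (meson Suc_leD rtranclp.rtrancl_into_rtrancl)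
  qed
  from this[of n] have "(mstep prog)\<^sup>*\<^sup>* (0, \<lambda>_. 0) (2 * n, (\<lambda>_. 0)(0 := n))" by simp
  moreover have "load_end n \<in> set prog" using assms by (simp add: loader_def)
  then have "mstep prog (2 * n, (\<lambda>_. 0)(0 := n)) (1, (\<lambda>_. 0)(0 := n))"
    by (auto simp: mstep_def load_end_def intro!: exI[of _ "DecJz 1 (2 * n) 1"])
  ultimately show ?thesis by (rule rtranclp.rtrancl_into_rtrancl)
qed

text \<open>
  The machine clears its registers first, so that it behaves in the same way whatever values a
  restart leaves in them. At label \<open>d\<close> it loops if the result is 0, and halts otherwise.
\<close>

lemma reduction:
  assumes "recursive 1 g"
  obtains Q where "star_free Q"
    "\<And>n. g [n] = 1 \<Longrightarrow> start_instance Q n \<notin> eventual_adaptation"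
    "\<And>n. g [n] = 0 \<Longrightarrow> start_instance Q n \<in> eventual_adaptation"
proof -
  have "computable 1 g" using recursive_computable[OF assms] .
  then obtain c where c: "\<And>s s'. (\<forall>r\<ge>2. s r = 0) \<Longrightarrow> s' = s(1 := s 1 + g (map s [0])) \<Longrightarrow> exec c s s'"
    using computableE[of 1 g "[0]" 2 1] by auto
  \<comment> \<open>Odd labels: \<open>c\<close> occupies 1 to \<open>d - 2\<close>, the decision is
    taken at \<open>d\<close>, \<open>d + 2\<close> is left without instruction for halting, and the
    clearing of the registers starts at \<open>d + 4\<close> and exits to the loader at 0.\<close>
  define d where "d = 1 + 2 * len c"
  define h where "h = d + 2"
  define st where "st = d + 4"
  define body where "body = compile c 1 d @ [(d, DecJz 1 h d)]"
  have "finite (prog_regs body)" by (simp add: prog_regs_def)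
  then obtain m where m: "prog_regs body \<subseteq> {..m}" unfolding finite_nat_set_iff_bounded_le by blast
  \<comment> \<open>The registers cleared by \<open>clear 0 (Suc m)\<close> are 0 to
    \<open>m + 1\<close>, precisely those below \<open>k\<close>; they include the registers 0 and 1
    used by the loader. Nothing here depends on the input.\<close>
  define k where "k = m + 2"
  define prog where "prog = body @ compile (clear 0 (Suc m)) st 0"
  have mach: "start_machine prog n h k" for n
  proof
    have labels: "map fst (prog @ loader n) = map (\<lambda>j. 1 + 2 * j) [0..<len c] @ d #
        map (\<lambda>j. st + 2 * j) [0..<len (clear 0 (Suc m))] @ 2 * n # map (\<lambda>j. 2 * j) [0..<n]"
      by (simp add: prog_def body_def compile_labels loader_def load_end_def load_def comp_def
        del: clear.simps)
    have parity: "1 + 2 * i \<noteq> 2 * j" for i j :: nat by presburger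
    have odd: "d = 1 + 2 * len c" "st = 1 + 2 * (len c + 2)" "h = 1 + 2 * (len c + 1)"
      by (simp_all add: st_def d_def h_def)
    show "distinct (map fst (prog @ loader n))"
      unfolding labels odd by (auto simp: distinct_map inj_on_def parity) (presburger+)?
    have "h \<notin> set (map fst (prog @ loader n))"
      unfolding labels odd by auto presburger+
    then show "h \<notin> fst ` set (prog @ loader n)" by (simp only: set_map not_False_eq_True)
    have "prog_regs (prog @ loader n) = prog_regs body \<union>
        prog_regs (compile (clear 0 (Suc m)) st 0) \<union> prog_regs (loader n)"
      by (simp add: prog_def prog_regs_def image_Un Un_assoc del: clear.simps)
    moreover have "prog_regs (loader n) \<subseteq> {..<k}"
      by (auto simp: prog_regs_def loader_def load_end_def load_def k_def)
    ultimately show "prog_regs (prog @ loader n) \<subseteq> {..<k}"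
      using m clear_regs[of 0 "Suc m" st 0] by (auto simp: k_def)
  qed
  let ?Q = "machine_proc prog h st k"
  define final :: "nat \<Rightarrow> nat \<Rightarrow> nat \<Rightarrow> nat" where "final n x = (\<lambda>_. 0)(0 := n, 1 := x)" for n x
  have run: "(mstep (prog @ loader n))\<^sup>*\<^sup>* (st, s0) (d, final n (g [n]))" if "within k s0" for n s0
  proof -
    have "exec (clear 0 (Suc m)) s0 (\<lambda>_. 0)"
      by (rule exec_eq[OF exec_clear]) (use that in \<open>auto simp: within_def k_def fun_eq_iff\<close>)
    then have "(mstep (prog @ loader n))\<^sup>*\<^sup>* (st, s0) (0, \<lambda>_. 0)"
      by (rule compile_exec) (auto simp: prog_def simp del: clear.simps)
    also have "(mstep (prog @ loader n))\<^sup>*\<^sup>* (0, \<lambda>_. 0) (1, (\<lambda>_. 0)(0 := n))"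
      by (rule loader_runs) simp
    also have "exec c ((\<lambda>_. 0)(0 := n)) (final n (g [n]))"
      by (rule c) (auto simp: final_def)
    then have "(mstep (prog @ loader n))\<^sup>*\<^sup>* (1, (\<lambda>_. 0)(0 := n)) (d, final n (g [n]))"
      by (rule compile_exec) (auto simp: prog_def body_def)
    finally show ?thesis .
  qed
  have d_in: "(d, DecJz 1 h d) \<in> set (prog @ loader n)" for n
    by (simp add: prog_def body_def)
  show thesis
  proof (rule that[of ?Q])
    show "star_free ?Q" by (rule star_free_start)
    fix n
    interpret start_machine prog n h st k by (rule mach)
    show "start_instance ?Q n \<notin> eventual_adaptation" if g: "g [n] = 1"
    proof (rule start_adaptation_halts)
      fix s0 assume "within k s0"
      note run[OF this, of n]
      \<comment> \<open>The decision consumes the result 1, and the contents at \<open>h\<close> do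
        not depend on \<open>s0\<close>, as repeated rounds require.\<close>
      also have "mstep (prog @ loader n) (d, final n (g [n])) (h, (\<lambda>_. 0)(0 := n))"
        unfolding mstep_def
        by (rule exI[of _ "DecJz 1 h d"]) (use d_in in \<open>auto simp: g final_def\<close>)
      finally show "(mstep (prog @ loader n))\<^sup>*\<^sup>* (st, s0) (h, (\<lambda>_. 0)(0 := n))" .
    qed
    show "start_instance ?Q n \<in> eventual_adaptation" if g: "g [n] = 0"
    proof (rule start_adaptation_never_halts, intro allI impI notI)
      fix l s assume "reachable l s" "l = h"
      then obtain s0 where s0: "within k s0" "(mstep (prog @ loader n))\<^sup>*\<^sup>* (st, s0) (h, s)"
        by (auto simp: reachable_def)
      have loop: "mstep (prog @ loader n) (d, final n 0) (d, final n 0)"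
        unfolding mstep_def
        by (rule exI[of _ "DecJz 1 h d"]) (use d_in in \<open>auto simp: final_def\<close>)
      \<comment> \<open>Either \<open>h\<close> would be reached from the loop at \<open>d\<close>,
        which is never left, or a run would leave \<open>h\<close>, where there is no
        instruction.\<close>
      from mstep_confluent[OF run[OF s0(1), of n, unfolded g] s0(2)] show False
      proof
        assume "(mstep (prog @ loader n))\<^sup>*\<^sup>* (d, final n 0) (h, s)"
        then have "(h, s) = (d, final n 0)"
          by (induction rule: rtranclp_induct) (use loop mstep_unique in auto)
        then show False by (simp add: h_def)
      next
        assume "(mstep (prog @ loader n))\<^sup>*\<^sup>* (h, s) (d, final n 0)"
        then show False
        proof (cases rule: converse_rtranclpE)
          case base
          then show False by (simp add: h_def)
        next
          case (step y)
          then show False using h by (force simp: mstep_def)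
        qed
      qed
    qed
  qed
qed

theorem theorem8p3:
  shows "\<not> decidable encode_instance adaptation_instances eventual_adaptation"
proof
  assume "decidable encode_instance adaptation_instances eventual_adaptation"
  then obtain f where f: "recursive 1 f" "\<And>x. x \<in> adaptation_instances \<Longrightarrow>
      f [encode_instance x] = (if x \<in> eventual_adaptation then 1 else 0)"
    unfolding decidable_def by blast
  obtain S where S: "recursive 1 S"
    "\<And>Q n. n = encode_proc Q \<Longrightarrow> S [n] = encode_instance (start_instance Q n)"
    by (rule recfun_start_instance) blast
  have "recursive 1 (\<lambda>xs. f (map (\<lambda>g. g xs) [S]))"
    using f(1) S(1) by (intro recursive.comp) simp_all
  then obtain Q where Q: "star_free Q"
    "\<And>n. f [S [n]] = 1 \<Longrightarrow> start_instance Q n \<notin> eventual_adaptation"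
    "\<And>n. f [S [n]] = 0 \<Longrightarrow> start_instance Q n \<in> eventual_adaptation"
    by (rule reduction) auto
  define x where "x = start_instance Q (encode_proc Q)"
  have "x \<in> adaptation_instances"
    using Q(1) star_free_start(2)
    by (simp add: x_def start_instance_def adaptation_instances_def token_def)
  from f(2)[OF this] have "f [S [encode_proc Q]] = (if x \<in> eventual_adaptation then 1 else 0)"
    by (simp add: x_def S(2))
  then show False
    using Q(2,3)[of "encode_proc Q"] unfolding x_def[symmetric] by (cases "x \<in> eventual_adaptation") simp_all
qed

end
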